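(* Let $G=(V,E)$ be a finite simple graph. The deformation cone $\mathbb{DC}(Z_G)$ of the graphical zonotope $Z_G$ is simplicial (modulo its lineality space) if and only if $G$ is triangle-free.
   Context: $(\mathbf{e}_v)_{v\in V}$ is the canonical basis of $\mathbb{R}^V$. The graphical zonotope is the Minkowski sum $Z_G=\sum_{\{u,v\}\in E}[\mathbf{e}_u,\mathbf{e}_v]\subset\mathbb{R}^V$. $G$ is triangle-free if it has no three pairwise adjacent vertices. A (nonempty) polytope $P\subset\mathbb{R}^V$ is a weak Minkowski summand, or deformation, of a polytope $R\subset\mathbb{R}^V$ if there are $\lambda\ge 0$ and a polytope $Q$ with $P+Q=\lambda R$. The deformation cone $\mathbb{DC}(R)$ is the set of all deformations of $R$; it is a polyhedral cone in the real vector space of virtual polytopes, i.e. the vector space of formal differences $P-Q$ of polytopes in $\mathbb{R}^V$, modulo $(P_1-Q_1)=(P_2-Q_2)$ iff $P_1+Q_2=P_2+Q_1$, with addition induced by Minkowski addition, $\lambda(P-Q)=\lambda P-\lambda Q$ for $\lambda\ge0$ and $\lambda(P-Q)=(-\lambda)Q-(-\lambda)P$ for $\lambda<0$; a polytope $P$ is identified with $P-\{0\}$. The lineality space of $\mathbb{DC}(Z_G)$ (its largest linear subspace) is the space of translations, i.e. of one-point polytopes $\{t\}$, $t\in\mathbb{R}^V$. A pointed polyhedral cone is simplicial if its rays are linearly independent; $\mathbb{DC}(Z_G)$ is called simplicial when its quotient modulo the lineality space is simplicial. *)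

theory Defs
  imports "HOL-Analysis.Analysis"
begin

section \<open>Nonempty polytopes\<close>

typedef (overloaded) 'a npolytope = "{P :: 'a::euclidean_space set. polytope P \<and> P \<noteq> {}}"
  morphisms point_set Npolytope
  using polytope_sing by blast

setup_lifting type_definition_npolytope

lemma polytope_set_plus:
  fixes P Q :: "'a::euclidean_space set"
  assumes "polytope P" "polytope Q" shows "polytope (P + Q)"
proof -
  obtain S T where "finite S" "P = convex hull S" "finite T" "Q = convex hull T"
    using assms unfolding polytope_def by blast
  then show ?thesis
    by (metis convex_hull_set_plus finite_set_plus polytope_convex_hull)
qed

lemma set_plus_ne: "P \<noteq> {} \<Longrightarrow> Q \<noteq> {} \<Longrightarrow> P + Q \<noteq> {}" for P Q :: "'a::plus set"
  unfolding set_plus_def by blast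

lemma set_plus_cancel_subset:
  fixes P P' Q :: "'a::euclidean_space set"
  assumes sub: "P + Q \<subseteq> P' + Q"
    and P': "closed P'" "convex P'" and Q: "compact Q" "Q \<noteq> {}"
  shows "P \<subseteq> P'"
proof
  fix x assume x: "x \<in> P"
  show "x \<in> P'"
  proof (rule ccontr)
    assume "x \<notin> P'"
    then obtain a b where a: "a \<bullet> x < b" and b: "\<And>y. y \<in> P' \<Longrightarrow> b < a \<bullet> y"
      using separating_hyperplane_closed_point[OF P'(2,1)] by metis
    have "continuous_on Q (\<lambda>q. a \<bullet> q)" by (intro continuous_intros)
    then obtain q where q: "q \<in> Q" "\<And>r. r \<in> Q \<Longrightarrow> a \<bullet> q \<le> a \<bullet> r"
      using continuous_attains_inf[OF Q] by blast
    have "x + q \<in> P' + Q" using sub x q(1) by (auto intro: set_plus_intro)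
    then obtain p r where pr: "p \<in> P'" "r \<in> Q" "x + q = p + r" by (auto elim: set_plus_elim)
    have "a \<bullet> x + a \<bullet> q = a \<bullet> p + a \<bullet> r" using pr(3) by (metis inner_add_right)
    with a b[OF pr(1)] q(2)[OF pr(2)] show False by linarith
  qed
qed

instantiation npolytope :: (euclidean_space) comm_monoid_add
begin

lift_definition zero_npolytope :: "'a npolytope" is "{0}"
  by (simp add: polytope_sing)

lift_definition plus_npolytope :: "'a npolytope \<Rightarrow> 'a npolytope \<Rightarrow> 'a npolytope" is "(+)"
  by (simp add: polytope_set_plus set_plus_ne)

instance
proof
  fix a b c :: "'a npolytope"
  show "a + b + c = a + (b + c)" by transfer (simp add: add.assoc)
  show "a + b = b + a" by transfer (simp add: add.commute)
  show "0 + a = a" by transfer (metis add_0 set_zero)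
qed

end

lemma npolytope_cancel [simp]:
  "P + Q = P' + Q \<longleftrightarrow> P = P'" for P P' Q :: "'a::euclidean_space npolytope"
proof
  assume "P + Q = P' + Q"
  then show "P = P'"
  proof transfer
    fix Q P P' :: "'a set"
    assume "polytope P \<and> P \<noteq> {}" "polytope Q \<and> Q \<noteq> {}" "polytope P' \<and> P' \<noteq> {}" "P + Q = P' + Q"
    then show "P = P'"
      using set_plus_cancel_subset[of P Q P'] set_plus_cancel_subset[of P' Q P]
      by (metis order_refl polytope_imp_closed polytope_imp_compact
          polytope_imp_convex subset_antisym)
  qed
qed simp

lift_definition dilate :: "real \<Rightarrow> 'a::euclidean_space npolytope \<Rightarrow> 'a npolytope"
  is "\<lambda>c P. (*\<^sub>R) c ` P"
  by (simp add: polytope_scaling)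

lemma dilate_1 [simp]: "dilate 1 P = P"
  by transfer simp

lemma dilate_0 [simp]: "dilate 0 P = 0"
  by transfer auto

lemma dilate_zero [simp]: "dilate c 0 = 0"
  by transfer simp

lemma dilate_dilate: "dilate a (dilate b P) = dilate (a * b) P"
  by transfer (simp add: image_image)

lemma dilate_plus: "dilate c (P + Q) = dilate c P + dilate c Q"
  by transfer (force simp: set_plus_def scaleR_add_right image_iff)

lemma dilate_add:
  assumes "a \<ge> 0" "b \<ge> 0" shows "dilate (a + b) P = dilate a P + dilate b P"
  using assms
proof transfer
  fix a b :: real and P :: "'a set"
  assume ab: "0 \<le> a" "0 \<le> b" and "polytope P \<and> P \<noteq> {}"
  then have P: "convex P" "P \<noteq> {}" by (auto intro: polytope_imp_convex)
  show "(*\<^sub>R) (a + b) ` P = (*\<^sub>R) a ` P + (*\<^sub>R) b ` P"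
  proof (cases "a + b = 0")
    case True
    then have "a = 0" "b = 0" using ab by auto
    then show ?thesis using P(2) by (auto simp: set_plus_def)
  next
    case False
    then have pos: "a + b > 0" using ab by auto
    have "a *\<^sub>R p + b *\<^sub>R q \<in> (*\<^sub>R) (a + b) ` P" if "p \<in> P" "q \<in> P" for p q
    proof (rule image_eqI)
      show "(a / (a + b)) *\<^sub>R p + (b / (a + b)) *\<^sub>R q \<in> P"
        using pos ab that P(1) by (intro convexD) (auto simp: add_divide_distrib[symmetric])
      show "a *\<^sub>R p + b *\<^sub>R q = (a + b) *\<^sub>R ((a / (a + b)) *\<^sub>R p + (b / (a + b)) *\<^sub>R q)"
        using pos by (simp add: scaleR_add_right)
    qed
    then show ?thesis by (auto simp: set_plus_def scaleR_add_left)
  qed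
qed

section \<open>Virtual polytopes\<close>

text \<open>A pair \<open>(P, Q)\<close> stands for the formal difference \<open>P - Q\<close>.\<close>
definition vpoly_rel ::
    "'a::euclidean_space npolytope \<times> 'a npolytope \<Rightarrow> 'a npolytope \<times> 'a npolytope \<Rightarrow> bool" where
  "vpoly_rel = (\<lambda>(P1, Q1) (P2, Q2). P1 + Q2 = P2 + Q1)"

quotient_type (overloaded) 'a vpolytope = "'a::euclidean_space npolytope \<times> 'a npolytope" / vpoly_rel
proof (rule equivpI)
  show "transp (vpoly_rel :: _ \<Rightarrow> 'a npolytope \<times> 'a npolytope \<Rightarrow> bool)"
  proof (rule transpI, clarsimp simp: vpoly_rel_def)
    fix P1 Q1 P2 Q2 P3 Q3 :: "'a npolytope"
    assume "P1 + Q2 = P2 + Q1" "P2 + Q3 = P3 + Q2"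
    then have "(P1 + Q3) + Q2 = (P3 + Q1) + Q2" by (metis add.assoc add.commute)
    then show "P1 + Q3 = P3 + Q1" by simp
  qed
qed (auto simp: vpoly_rel_def reflp_def symp_def)

definition vpoly_scale ::
    "real \<Rightarrow> 'a::euclidean_space npolytope \<times> 'a npolytope \<Rightarrow> 'a npolytope \<times> 'a npolytope" where
  "vpoly_scale = (\<lambda>c (P, Q).
     if c \<ge> 0 then (dilate c P, dilate c Q) else (dilate (- c) Q, dilate (- c) P))"

lemma vpoly_rel_scale:
  assumes "vpoly_rel x y" shows "vpoly_rel (vpoly_scale c x) (vpoly_scale c y)"
proof -
  obtain P1 Q1 P2 Q2 where xy: "x = (P1, Q1)" "y = (P2, Q2)"
    by (cases x, cases y) blast
  have 1: "dilate d P1 + dilate d Q2 = dilate d P2 + dilate d Q1" for d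
    using assms by (simp add: vpoly_rel_def dilate_plus[symmetric] xy)
  have 2: "dilate d Q1 + dilate d P2 = dilate d Q2 + dilate d P1" for d
    using 1[of d] by (simp only: add.commute)
  show ?thesis
    by (simp add: vpoly_rel_def vpoly_scale_def xy 1 2)
qed

lemma vpoly_scale_rel:
  assumes "c = p - n" "p \<ge> 0" "n \<ge> 0"
  shows "vpoly_rel (vpoly_scale c (P, Q)) (dilate p P + dilate n Q, dilate p Q + dilate n P)"
proof (cases "c \<ge> 0")
  case True
  have p: "p = c + n" using assms(1) by simp
  have "dilate c P + (dilate p Q + dilate n P) = (dilate p P + dilate n Q) + dilate c Q"
    unfolding p dilate_add[OF True assms(3)] by (simp only: ac_simps)
  then show ?thesis using True by (simp only: vpoly_scale_def vpoly_rel_def if_True prod.case)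
next
  case False
  have n: "n = - c + p" using assms(1) by simp
  have c: "0 \<le> - c" using False by simp
  have "dilate (- c) Q + (dilate p Q + dilate n P) = (dilate p P + dilate n Q) + dilate (- c) P"
    unfolding n dilate_add[OF c assms(2)] by (simp only: ac_simps)
  then show ?thesis using False by (simp only: vpoly_scale_def vpoly_rel_def if_False prod.case)
qed

instantiation vpolytope :: (euclidean_space) real_vector
begin

lift_definition zero_vpolytope :: "'a vpolytope" is "(0, 0)" .

lift_definition plus_vpolytope :: "'a vpolytope \<Rightarrow> 'a vpolytope \<Rightarrow> 'a vpolytope"
  is "\<lambda>(P1, Q1) (P2, Q2). (P1 + P2, Q1 + Q2)"
proof (clarsimp simp: vpoly_rel_def)
  fix P1 Q1 P2 Q2 R1 S1 R2 S2 :: "'a npolytope"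
  assume 1: "P1 + Q2 = P2 + Q1" and 2: "R1 + S2 = R2 + S1"
  have "(P1 + R1) + (Q2 + S2) = (P1 + Q2) + (R1 + S2)" by (simp only: ac_simps)
  also have "\<dots> = (P2 + R2) + (Q1 + S1)" unfolding 1 2 by (simp only: ac_simps)
  finally show "(P1 + R1) + (Q2 + S2) = (P2 + R2) + (Q1 + S1)" .
qed

lift_definition uminus_vpolytope :: "'a vpolytope \<Rightarrow> 'a vpolytope"
  is "\<lambda>(P, Q). (Q, P)"
  by (clarsimp simp: vpoly_rel_def) (metis add.commute)

definition minus_vpolytope :: "'a vpolytope \<Rightarrow> 'a vpolytope \<Rightarrow> 'a vpolytope" where
  "minus_vpolytope x y = x + (- y)"

lift_definition scaleR_vpolytope :: "real \<Rightarrow> 'a vpolytope \<Rightarrow> 'a vpolytope" is vpoly_scale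
  by (rule vpoly_rel_scale)

lemma scaleR_vpoly_eq:
  assumes "c = p - n" "p \<ge> 0" "n \<ge> 0"
  shows "c *\<^sub>R abs_vpolytope (P, Q) = abs_vpolytope (dilate p P + dilate n Q, dilate p Q + dilate n P)"
  unfolding scaleR_vpolytope.abs_eq vpolytope.abs_eq_iff by (rule vpoly_scale_rel[OF assms])

lemma plus_vpoly_eq:
  "abs_vpolytope (P1, Q1) + abs_vpolytope (P2, Q2) = abs_vpolytope (P1 + P2, Q1 + Q2)"
  by (simp add: plus_vpolytope.abs_eq)

lemma vpoly_eq_iff:
  "abs_vpolytope (P1, Q1) = abs_vpolytope (P2, Q2) \<longleftrightarrow> P1 + Q2 = P2 + Q1"
  by (simp add: vpolytope.abs_eq_iff vpoly_rel_def)

lemma vpoly_cases: obtains P Q where "x = abs_vpolytope (P, Q)"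
  by (induction x rule: vpolytope.abs_induct) (metis surj_pair)

instance
proof
  fix x y z :: "'a vpolytope" and a b :: real
  obtain P1 Q1 where x: "x = abs_vpolytope (P1, Q1)" by (rule vpoly_cases)
  obtain P2 Q2 where y: "y = abs_vpolytope (P2, Q2)" by (rule vpoly_cases)
  obtain P3 Q3 where z: "z = abs_vpolytope (P3, Q3)" by (rule vpoly_cases)
  show "x + y + z = x + (y + z)" by (simp add: x y z plus_vpoly_eq add.assoc)
  show "x + y = y + x" by (simp add: x y plus_vpoly_eq add.commute)
  show "0 + x = x" by (simp add: x zero_vpolytope_def plus_vpoly_eq)
  show "- x + x = 0"
    by (simp add: x zero_vpolytope_def uminus_vpolytope.abs_eq plus_vpoly_eq vpoly_eq_iff add.commute)
  show "x - y = x + - y" by (rule minus_vpolytope_def)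
  define pa na pb nb where defs: "pa = max a 0" "na = max (- a) 0" "pb = max b 0" "nb = max (- b) 0"
  have pos: "pa \<ge> 0" "na \<ge> 0" "pb \<ge> 0" "nb \<ge> 0" by (auto simp: defs)
  have a: "a = pa - na" and b: "b = pb - nb" by (auto simp: defs)
  show "a *\<^sub>R (x + y) = a *\<^sub>R x + a *\<^sub>R y"
    by (simp add: x y plus_vpoly_eq scaleR_vpoly_eq[OF a pos(1,2)] dilate_plus ac_simps)
  have ab: "a + b = (pa + pb) - (na + nb)" using a b by simp
  show "(a + b) *\<^sub>R x = a *\<^sub>R x + b *\<^sub>R x"
    using pos
    by (simp add: x plus_vpoly_eq scaleR_vpoly_eq[OF a pos(1,2)] scaleR_vpoly_eq[OF b pos(3,4)]
        scaleR_vpoly_eq[OF ab] dilate_add ac_simps)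
  have ab: "a * b = (pa * pb + na * nb) - (pa * nb + na * pb)" by (simp add: a b algebra_simps)
  show "a *\<^sub>R b *\<^sub>R x = (a * b) *\<^sub>R x"
    using pos
    by (simp add: x scaleR_vpoly_eq[OF a pos(1,2)] scaleR_vpoly_eq[OF b pos(3,4)]
        scaleR_vpoly_eq[OF ab] dilate_add dilate_plus dilate_dilate ac_simps)
  show "1 *\<^sub>R x = x"
    by (simp add: x scaleR_vpolytope.abs_eq vpoly_scale_def)
qed

end

text \<open>The identification of a polytope \<open>P\<close> with the formal difference \<open>P - {0}\<close>.\<close>
definition virtual :: "'a::euclidean_space npolytope \<Rightarrow> 'a vpolytope" where
  "virtual P = abs_vpolytope (P, 0)"

lemma virtual_eq_iff [simp]: "virtual P = virtual Q \<longleftrightarrow> P = Q"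
  by (simp add: virtual_def vpoly_eq_iff)

lemma virtual_0 [simp]: "virtual 0 = 0"
  by (simp add: virtual_def zero_vpolytope_def)

lemma virtual_plus: "virtual (P + Q) = virtual P + virtual Q"
  by (simp add: virtual_def plus_vpoly_eq)

lemma virtual_dilate: "c \<ge> 0 \<Longrightarrow> virtual (dilate c P) = c *\<^sub>R virtual P"
  by (simp add: virtual_def scaleR_vpoly_eq[of c c 0])

lemma abs_vpolytope_eq: "abs_vpolytope (P, Q) = virtual P - virtual Q"
proof -
  have "abs_vpolytope (P, Q) + virtual Q = virtual P"
    by (simp add: virtual_def plus_vpoly_eq vpoly_eq_iff)
  then show ?thesis by (simp add: algebra_simps)
qed

lift_definition point :: "'a::euclidean_space \<Rightarrow> 'a npolytope" is "\<lambda>t. {t}"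
  by (simp add: polytope_sing)

lemma point_0: "point 0 = 0"
  by transfer simp

lemma point_plus: "point (s + t) = point s + point t"
  by transfer (simp add: set_plus_def)

lemma dilate_point: "dilate c (point t) = point (c *\<^sub>R t)"
  by transfer simp

lemma linear_virtual_point: "linear (\<lambda>t. virtual (point t))"
proof (rule linearI)
  show add: "virtual (point (s + t)) = virtual (point s) + virtual (point t)" for s t :: 'a
    by (simp add: point_plus virtual_plus)
  show "virtual (point (c *\<^sub>R t)) = c *\<^sub>R virtual (point t)" for c and t :: 'a
  proof (cases "c \<ge> 0")
    case True
    then show ?thesis using virtual_dilate[of c "point t"] by (simp add: dilate_point)
  next
    case False
    have "virtual (point (c *\<^sub>R t)) + virtual (point ((- c) *\<^sub>R t)) = 0"
      by (simp add: add[symmetric] point_0)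
    moreover have "virtual (point ((- c) *\<^sub>R t)) = (- c) *\<^sub>R virtual (point t)"
      using False virtual_dilate[of "- c" "point t"] by (simp add: dilate_point)
    ultimately show ?thesis by simp
  qed
qed

section \<open>Deformation cones\<close>

definition weak_minkowski_summand ::
    "'a::euclidean_space npolytope \<Rightarrow> 'a npolytope \<Rightarrow> bool" where
  "weak_minkowski_summand P R \<longleftrightarrow> (\<exists>c\<ge>0. \<exists>Q. P + Q = dilate c R)"

definition deformation_cone :: "'a::euclidean_space npolytope \<Rightarrow> 'a vpolytope set" where
  "deformation_cone R = virtual ` {P. weak_minkowski_summand P R}"

text \<open>The largest linear subspace; meaningful for convex cones.\<close>
definition lineality_space :: "'b::real_vector set \<Rightarrow> 'b set" where
  "lineality_space C = (GREATEST L. subspace L \<and> L \<subseteq> C)"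

definition translation_space :: "'a::euclidean_space vpolytope set" where
  "translation_space = range (\<lambda>t. virtual (point t))"

lemma subspace_translation_space: "subspace translation_space"
  unfolding translation_space_def by (rule linear_subspace_image[OF linear_virtual_point subspace_UNIV])

lemma npolytope_plus_eq_0D:
  assumes "P + Q = 0" shows "\<exists>t. P = point t"
  using assms
proof transfer
  fix P Q :: "'a set"
  assume PQ: "polytope P \<and> P \<noteq> {}" "polytope Q \<and> Q \<noteq> {}" "P + Q = {0}"
  then obtain q where "q \<in> Q" by blast
  then have "\<And>p. p \<in> P \<Longrightarrow> p + q = 0" using PQ(3) by (metis set_plus_intro singletonD)
  then have "P \<subseteq> {- q}" by (auto simp: eq_neg_iff_add_eq_0)
  then show "\<exists>t. P = {t}" using PQ(1) by blast
qed

theorem lineality_space_deformation_cone: "lineality_space (deformation_cone R) = translation_space"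
  unfolding lineality_space_def
proof (rule Greatest_equality, intro conjI)
  show "subspace (translation_space :: 'a vpolytope set)" by (rule subspace_translation_space)
  show "translation_space \<subseteq> deformation_cone R"
  proof (clarsimp simp: translation_space_def deformation_cone_def)
    fix t
    have "point t + (point (- t) + R) = dilate 1 R"
      by (simp add: add.assoc[symmetric] point_plus[symmetric] point_0)
    then show "virtual (point t) \<in> virtual ` {P. weak_minkowski_summand P R}"
      unfolding weak_minkowski_summand_def by (metis (mono_tags) imageI mem_Collect_eq zero_le_one)
  qed
  fix L assume L: "subspace L \<and> L \<subseteq> deformation_cone R"
  show "L \<le> translation_space"
  proof
    fix x assume "x \<in> L"
    then have "x \<in> deformation_cone R" "- x \<in> deformation_cone R"
      using L by (auto simp: subspace_neg)
    then obtain P Q where P: "x = virtual P" and Q: "- x = virtual Q"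
      unfolding deformation_cone_def by blast
    have "virtual (P + Q) = virtual P + virtual Q" by (rule virtual_plus)
    also have "\<dots> = virtual 0" by (simp only: P[symmetric] Q[symmetric] virtual_0 right_minus)
    finally have "P + Q = 0" by (simp only: virtual_eq_iff)
    then show "x \<in> translation_space" using npolytope_plus_eq_0D P unfolding translation_space_def by blast
  qed
qed

section \<open>The quotient by the lineality space\<close>

text \<open>By the theorem above the lineality space is the space of translations for every polytope,
  so a single quotient type serves all deformation cones.\<close>

definition trans_rel :: "'a::euclidean_space vpolytope \<Rightarrow> 'a vpolytope \<Rightarrow> bool" where
  "trans_rel x y \<longleftrightarrow> x - y \<in> translation_space"

quotient_type (overloaded) 'a vpolytope_mod = "'a::euclidean_space vpolytope" / trans_rel
  morphisms rep_vpolytope_mod mod_translations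
proof (rule equivpI)
  show "reflp (trans_rel :: 'a vpolytope \<Rightarrow> _)"
    by (simp add: reflp_def trans_rel_def subspace_0 subspace_translation_space)
  show "symp (trans_rel :: 'a vpolytope \<Rightarrow> _)"
    unfolding symp_def trans_rel_def using subspace_neg[OF subspace_translation_space] by fastforce
  show "transp (trans_rel :: 'a vpolytope \<Rightarrow> _)"
    unfolding transp_def trans_rel_def using subspace_add[OF subspace_translation_space] by fastforce
qed

instantiation vpolytope_mod :: (euclidean_space) real_vector
begin

lift_definition zero_vpolytope_mod :: "'a vpolytope_mod" is 0 .

lift_definition plus_vpolytope_mod :: "'a vpolytope_mod \<Rightarrow> 'a vpolytope_mod \<Rightarrow> 'a vpolytope_mod"
  is "(+)"
  unfolding trans_rel_def add_diff_add by (rule subspace_add[OF subspace_translation_space])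

lift_definition uminus_vpolytope_mod :: "'a vpolytope_mod \<Rightarrow> 'a vpolytope_mod" is uminus
  unfolding trans_rel_def minus_diff_minus by (rule subspace_neg[OF subspace_translation_space])

lift_definition minus_vpolytope_mod :: "'a vpolytope_mod \<Rightarrow> 'a vpolytope_mod \<Rightarrow> 'a vpolytope_mod"
  is "(-)"
proof -
  fix x y z w :: "'a vpolytope"
  assume "trans_rel x y" "trans_rel z w"
  then have "(x - y) - (z - w) \<in> translation_space"
    unfolding trans_rel_def by (rule subspace_diff[OF subspace_translation_space])
  then show "trans_rel (x - z) (y - w)"
    unfolding trans_rel_def by (simp add: algebra_simps)
qed

lift_definition scaleR_vpolytope_mod :: "real \<Rightarrow> 'a vpolytope_mod \<Rightarrow> 'a vpolytope_mod" is scaleR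
  unfolding trans_rel_def scaleR_right_diff_distrib[symmetric]
  by (rule subspace_scale[OF subspace_translation_space])

lemmas vpolytope_mod_ops =
  zero_vpolytope_mod_def plus_vpolytope_mod.abs_eq uminus_vpolytope_mod.abs_eq
  minus_vpolytope_mod.abs_eq scaleR_vpolytope_mod.abs_eq

instance
proof
  fix x y z :: "'a vpolytope_mod" and a b :: real
  obtain u v w where [simp]: "x = mod_translations u" "y = mod_translations v" "z = mod_translations w"
    by (induction x rule: vpolytope_mod.abs_induct, induction y rule: vpolytope_mod.abs_induct,
        induction z rule: vpolytope_mod.abs_induct) blast
  show "x + y + z = x + (y + z)" by (simp add: vpolytope_mod_ops add.assoc)
  show "x + y = y + x" by (simp add: vpolytope_mod_ops add.commute)
  show "0 + x = x" by (simp add: vpolytope_mod_ops)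
  show "- x + x = 0" by (simp add: vpolytope_mod_ops)
  show "x - y = x + - y" by (simp add: vpolytope_mod_ops)
  show "a *\<^sub>R (x + y) = a *\<^sub>R x + a *\<^sub>R y" by (simp add: vpolytope_mod_ops scaleR_add_right)
  show "(a + b) *\<^sub>R x = a *\<^sub>R x + b *\<^sub>R x" by (simp add: vpolytope_mod_ops scaleR_add_left)
  show "a *\<^sub>R b *\<^sub>R x = (a * b) *\<^sub>R x" by (simp add: vpolytope_mod_ops)
  show "1 *\<^sub>R x = x" by (simp add: vpolytope_mod_ops)
qed

end

lemma linear_mod_translations: "linear mod_translations"
  by (rule linearI) (simp_all add: plus_vpolytope_mod.abs_eq scaleR_vpolytope_mod.abs_eq)

lemma mod_translations_eq_0_iff: "mod_translations x = 0 \<longleftrightarrow> x \<in> translation_space"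
  by (simp add: zero_vpolytope_mod_def vpolytope_mod.abs_eq_iff trans_rel_def)

corollary kernel_mod_translations:
  "{x. mod_translations x = 0} = lineality_space (deformation_cone R)"
  by (simp add: mod_translations_eq_0_iff lineality_space_deformation_cone)

section \<open>Simplicial cones\<close>

definition cone_rays :: "'b::real_vector set \<Rightarrow> 'b set set" where
  "cone_rays K = {F. F face_of K \<and> (\<exists>v. v \<noteq> 0 \<and> F = {c *\<^sub>R v | c. c \<ge> 0})}"

text \<open>Linear independence of a family of half-lines does not depend on the choice of
  a spanning vector for each of them.\<close>
definition independent_rays :: "'b::real_vector set \<Rightarrow> bool" where
  "independent_rays K \<longleftrightarrow>
     (\<forall>g. (\<forall>F\<in>cone_rays K. g F \<in> F \<and> g F \<noteq> 0) \<longrightarrow> independent (g ` cone_rays K))"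

text \<open>The ambient space of virtual polytopes is infinite-dimensional and has no inner product,
  so polyhedral cones are rendered as finitely generated ones (Minkowski--Weyl).\<close>
definition polyhedral_cone :: "'b::real_vector set \<Rightarrow> bool" where
  "polyhedral_cone K \<longleftrightarrow> (\<exists>S. finite S \<and> K = convex_cone hull S)"

definition simplicial_cone :: "'b::real_vector set \<Rightarrow> bool" where
  "simplicial_cone K \<longleftrightarrow> polyhedral_cone K \<and> lineality_space K = {0} \<and> independent_rays K"

section \<open>Graphical zonotopes\<close>

definition simple_graph :: "'v set set \<Rightarrow> bool" where
  "simple_graph E \<longleftrightarrow> (\<forall>e\<in>E. card e = 2)"

definition triangle_free :: "'v set set \<Rightarrow> bool" where
  "triangle_free E \<longleftrightarrow> \<not> (\<exists>u v w. {u, v} \<in> E \<and> {v, w} \<in> E \<and> {u, w} \<in> E)"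

text \<open>The Minkowski sum is the sum in the commutative monoid of sets; for an edge \<open>e = {u, v}\<close>
  the summand is the segment between the basis vectors \<open>axis u 1\<close> and \<open>axis v 1\<close>.\<close>
definition graphical_zonotope :: "'v::finite set set \<Rightarrow> (real ^ 'v) npolytope" where
  "graphical_zonotope E = Npolytope (\<Sum>e\<in>E. convex hull ((\<lambda>v. axis v 1) ` e))"

lemma point_set_graphical_zonotope:
  fixes E :: "'v::finite set set"
  assumes "simple_graph E"
  shows "point_set (graphical_zonotope E) = (\<Sum>e\<in>E. convex hull ((\<lambda>v. axis v 1) ` e))"
proof -
  let ?s = "\<lambda>e :: 'v set. convex hull ((\<lambda>v. axis v (1::real)) ` e)"
  have "polytope (\<Sum>e\<in>F. ?s e) \<and> (\<Sum>e\<in>F. ?s e) \<noteq> {}" if "F \<subseteq> E" for F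
    using finite[of F] that
  proof (induction F rule: finite_induct)
    case empty
    then show ?case by (simp add: polytope_sing)
  next
    case (insert e F)
    then have "e \<noteq> {}" using assms unfolding simple_graph_def by fastforce
    then have "polytope (?s e)" "?s e \<noteq> {}"
      by (auto simp: polytope_convex_hull)
    with insert show ?case by (simp add: polytope_set_plus set_plus_ne)
  qed
  then show ?thesis unfolding graphical_zonotope_def by (subst Npolytope_inverse) auto
qed

end

theory Submission
  imports Defs
begin

text \<open>A deformation \<open>P\<close> of \<open>Z\<^sub>G\<close> is determined by its support function \<open>h\<^sub>P\<close>, which is additive on
  comonotone vectors, hence by the submodular set function \<open>f(S) = h\<^sub>P(1\<^sub>S)\<close>; up to translation it is
  determined by the second differences \<open>f(S+u) + f(S+v) - f(S+u+v) - f(S)\<close>. These are nonnegative,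
  vanish if \<open>uv\<close> is not an edge, and their differences in a third vertex \<open>w\<close> are symmetric in
  \<open>u, v, w\<close>. If \<open>G\<close> is triangle-free, some pair among \<open>u, v, w\<close> is not an edge, so the second
  differences at an edge do not depend on \<open>S\<close>: they are the coefficients that write \<open>P\<close> as a nonnegative
  combination of the segments of the edges, which are linearly independent.
  Conversely a triangle \<open>abc\<close> yields five different rays, spanned by its three segments, by the simplex
  on \<open>a, b, c\<close> and by the reflected simplex, and they are linearly dependent because the sum of the
  segments and the sum of the two simplices are the same hexagon.\<close>

section \<open>Support functions\<close>

definition support_fun :: "'a::euclidean_space npolytope \<Rightarrow> 'a \<Rightarrow> real" where
  "support_fun P c = (SUP x\<in>point_set P. c \<bullet> x)"

lemma support_fun_eqI:
  assumes "x \<in> point_set P" "c \<bullet> x = m" "\<And>y. y \<in> point_set P \<Longrightarrow> c \<bullet> y \<le> m"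
  shows "support_fun P c = m"
  unfolding support_fun_def
  by (rule cSup_eq_maximum) (use assms in auto)

lemma support_fun_attained:
  obtains x where "x \<in> point_set P" "c \<bullet> x = support_fun P c"
    "\<And>y. y \<in> point_set P \<Longrightarrow> c \<bullet> y \<le> support_fun P c"
proof -
  have "polytope (point_set P)" "point_set P \<noteq> {}"
    using point_set[of P] by auto
  then obtain x where x: "x \<in> point_set P" "\<And>y. y \<in> point_set P \<Longrightarrow> c \<bullet> y \<le> c \<bullet> x"
    using continuous_attains_sup[of "point_set P" "\<lambda>y. c \<bullet> y"]
      continuous_on_inner[OF continuous_on_const continuous_on_id]
      polytope_imp_compact[of "point_set P"] by metis
  then show thesis using that support_fun_eqI[OF x(1) refl x(2)] by auto
qed

lemma support_fun_upper: "y \<in> point_set P \<Longrightarrow> c \<bullet> y \<le> support_fun P c"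
  by (metis support_fun_attained)

lemma support_fun_plus: "support_fun (P + Q) c = support_fun P c + support_fun Q c"
proof -
  obtain x where x: "x \<in> point_set P" "c \<bullet> x = support_fun P c" by (rule support_fun_attained)
  obtain y where y: "y \<in> point_set Q" "c \<bullet> y = support_fun Q c" by (rule support_fun_attained)
  show ?thesis
  proof (rule support_fun_eqI)
    show "x + y \<in> point_set (P + Q)" using x y by (simp add: plus_npolytope.rep_eq set_plus_intro)
    show "c \<bullet> (x + y) = support_fun P c + support_fun Q c" using x y by (simp add: inner_add_right)
    show "c \<bullet> z \<le> support_fun P c + support_fun Q c" if "z \<in> point_set (P + Q)" for z
      using that by (auto simp: plus_npolytope.rep_eq inner_add_right intro!: add_mono support_fun_upper
          elim!: set_plus_elim)
  qed
qed

lemma support_fun_0 [simp]: "support_fun 0 c = 0"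
  by (rule support_fun_eqI[of 0]) (auto simp: zero_npolytope.rep_eq)

lemma support_fun_sum: "support_fun (sum P A) c = (\<Sum>a\<in>A. support_fun (P a) c)"
  by (induction A rule: infinite_finite_induct) (auto simp: support_fun_plus)

lemma support_fun_point [simp]: "support_fun (point t) c = c \<bullet> t"
  by (rule support_fun_eqI[of t]) (auto simp: point.rep_eq)

lemma support_fun_dilate:
  assumes "r \<ge> 0" shows "support_fun (dilate r P) c = r * support_fun P c"
proof -
  obtain x where x: "x \<in> point_set P" "c \<bullet> x = support_fun P c" by (rule support_fun_attained)
  show ?thesis
    by (rule support_fun_eqI[of "r *\<^sub>R x"])
      (use x assms in \<open>auto simp: dilate.rep_eq support_fun_upper mult_left_mono\<close>)
qed

lemma support_fun_subadditive: "support_fun P (a + b) \<le> support_fun P a + support_fun P b"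
proof -
  obtain x where x: "x \<in> point_set P" "(a + b) \<bullet> x = support_fun P (a + b)"
    by (rule support_fun_attained)
  show ?thesis
    using support_fun_upper[OF x(1), of a] support_fun_upper[OF x(1), of b] x(2)
    by (simp add: inner_add_left)
qed

lemma support_fun_scaleR:
  assumes "r \<ge> 0" shows "support_fun P (r *\<^sub>R c) = r * support_fun P c"
proof -
  obtain x where x: "x \<in> point_set P" "c \<bullet> x = support_fun P c" by (rule support_fun_attained)
  show ?thesis
    by (rule support_fun_eqI[OF x(1)]) (use x assms in \<open>auto simp: support_fun_upper mult_left_mono\<close>)
qed

text \<open>Hyperplane separation: a point of \<open>P\<close> outside \<open>Q\<close> gives a
  direction in which \<open>P\<close> reaches farther than \<open>Q\<close>.\<close>

lemma npolytope_subset_if_support_le: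
  assumes "\<And>c. support_fun P c \<le> support_fun Q c"
  shows "point_set P \<subseteq> point_set Q"
proof
  fix x assume x: "x \<in> point_set P"
  show "x \<in> point_set Q"
  proof (rule ccontr)
    assume "x \<notin> point_set Q"
    moreover have "convex (point_set Q)" "closed (point_set Q)"
      using point_set[of Q] by (auto simp: polytope_imp_convex polytope_imp_closed)
    ultimately obtain a b where a: "a \<bullet> x < b" and b: "\<And>y. y \<in> point_set Q \<Longrightarrow> b < a \<bullet> y"
      using separating_hyperplane_closed_point by metis
    obtain y where y: "y \<in> point_set Q" "- a \<bullet> y = support_fun Q (- a)" by (rule support_fun_attained)
    then show False
      using a b[OF y(1)] support_fun_upper[OF x, of "- a"] assms[of "- a"] by simp
  qed
qed

lemma support_fun_inject:
  assumes "\<And>c. support_fun P c = support_fun Q c" shows "P = Q"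
  using npolytope_subset_if_support_le[of P Q] npolytope_subset_if_support_le[of Q P] assms
  by (simp add: point_set_inject[symmetric] subset_antisym)

section \<open>Convex hulls of finite sets and coordinate simplices\<close>

definition hull_polytope :: "'a::euclidean_space set \<Rightarrow> 'a npolytope" where
  "hull_polytope A = Npolytope (convex hull A)"

lemma point_set_hull_polytope:
  assumes "finite A" "A \<noteq> {}" shows "point_set (hull_polytope A) = convex hull A"
  unfolding hull_polytope_def by (rule Npolytope_inverse) (use assms in \<open>auto simp: polytope_convex_hull\<close>)

lemma support_fun_hull_polytope:
  assumes "finite A" "A \<noteq> {}"
  shows "support_fun (hull_polytope A) c = Max ((\<bullet>) c ` A)"
proof -
  let ?m = "Max ((\<bullet>) c ` A)"
  have "?m \<in> (\<bullet>) c ` A" using assms by simp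
  then obtain x where x: "x \<in> A" "c \<bullet> x = ?m" by (metis imageE)
  have "convex hull A \<subseteq> {y. c \<bullet> y \<le> ?m}"
    by (rule hull_minimal) (use assms in \<open>auto simp: convex_halfspace_le\<close>)
  with x show ?thesis
    by (intro support_fun_eqI[of x]) (auto simp: point_set_hull_polytope assms hull_inc)
qed

text \<open>On a two-element set this is the segment of an edge, so edges and triangles share the
  same formulas.\<close>

definition simplex_on :: "'v::finite set \<Rightarrow> (real ^ 'v) npolytope" where
  "simplex_on A = hull_polytope ((\<lambda>v. axis v 1) ` A)"

lemma support_fun_simplex_on:
  assumes "A \<noteq> {}" shows "support_fun (simplex_on A) c = Max ((\<lambda>v. c $ v) ` A)"
  using assms by (simp add: simplex_on_def support_fun_hull_polytope image_image inner_axis)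

lemma graphical_zonotope_eq_sum:
  assumes "simple_graph E" shows "graphical_zonotope E = (\<Sum>e\<in>E. simplex_on e)"
proof -
  have "point_set (\<Sum>e\<in>F. simplex_on e) = (\<Sum>e\<in>F. convex hull ((\<lambda>v. axis v 1) ` e))"
    if "F \<subseteq> E" for F
    using finite[of F] that
  proof (induction F rule: finite_induct)
    case empty
    then show ?case by (simp add: zero_npolytope.rep_eq)
  next
    case (insert e F)
    then have "e \<noteq> {}" using assms unfolding simple_graph_def by fastforce
    with insert show ?case
      by (simp add: plus_npolytope.rep_eq simplex_on_def point_set_hull_polytope)
  qed
  then show ?thesis
    using point_set_graphical_zonotope[OF assms] by (simp add: point_set_inject[symmetric])
qed

section \<open>Second differences of support functions\<close>

text \<open>Additivity of support functions under Minkowski sums makes the difference independent of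
  the representing pair.\<close>

lift_definition vsupport :: "'a::euclidean_space vpolytope \<Rightarrow> 'a \<Rightarrow> real"
  is "\<lambda>(P, Q) c. support_fun P c - support_fun Q c"
proof (clarsimp simp: vpoly_rel_def fun_eq_iff)
  fix P Q P' Q' :: "'a npolytope" and c
  assume "P + Q' = P' + Q"
  then have "support_fun (P + Q') c = support_fun (P' + Q) c" by simp
  then show "support_fun P c - support_fun Q c = support_fun P' c - support_fun Q' c"
    by (simp add: support_fun_plus)
qed

lemma vsupport_virtual [simp]: "vsupport (virtual P) c = support_fun P c"
  by (simp add: virtual_def vsupport.abs_eq)

lemma vsupport_add: "vsupport (x + y) c = vsupport x c + vsupport y c"
  by transfer (auto simp: support_fun_plus)

lemma vsupport_scaleR: "vsupport (r *\<^sub>R x) c = r * vsupport x c"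
  by transfer (auto simp: vpoly_scale_def support_fun_dilate algebra_simps)

text \<open>For \<open>u \<noteq> v\<close> outside \<open>S\<close>, \<open>curv u v (ind S)\<close> measures the failure of modularity at \<open>S\<close> of the
  set function \<open>S \<mapsto> h\<^sub>P(ind S)\<close>; translations have zero second differences.\<close>
lift_definition curv :: "'v::finite \<Rightarrow> 'v \<Rightarrow> real ^ 'v \<Rightarrow> (real ^ 'v) vpolytope_mod \<Rightarrow> real"
  is "\<lambda>u v c x. vsupport x (c + axis u 1) + vsupport x (c + axis v 1)
        - vsupport x (c + axis u 1 + axis v 1) - vsupport x c"
proof -
  fix u v :: 'v and c :: "real ^ 'v" and x y :: "(real ^ 'v) vpolytope"
  assume "trans_rel x y"
  then obtain t where "x - y = virtual (point t)"
    unfolding trans_rel_def translation_space_def by blast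
  then have "x = y + virtual (point t)" by (simp add: algebra_simps)
  then show "vsupport x (c + axis u 1) + vsupport x (c + axis v 1)
        - vsupport x (c + axis u 1 + axis v 1) - vsupport x c =
      vsupport y (c + axis u 1) + vsupport y (c + axis v 1)
        - vsupport y (c + axis u 1 + axis v 1) - vsupport y c"
    by (simp add: vsupport_add inner_add_left)
qed

lemma curv_add: "curv u v c (x + y) = curv u v c x + curv u v c y"
  by transfer (simp add: vsupport_add)

lemma curv_scaleR: "curv u v c (r *\<^sub>R x) = r * curv u v c x"
  by transfer (simp add: vsupport_scaleR algebra_simps)

lemma linear_curv: "linear (curv u v c)"
  by (rule linearI) (auto simp: curv_add curv_scaleR)

lemma curv_commute: "curv u v c x = curv v u c x"
  by transfer (simp add: add.commute add.left_commute)

text \<open>Both sides are the negated third difference along the basis vectors of \<open>u\<close>,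
  \<open>v\<close>, \<open>w\<close>, which is symmetric in the three directions.\<close>

lemma curv_third_difference:
  "curv u v (c + axis w 1) x - curv u v c x = curv u w (c + axis v 1) x - curv u w c x"
  by transfer (simp add: add.commute add.left_commute)

definition to_mod :: "'a::euclidean_space npolytope \<Rightarrow> 'a vpolytope_mod" where
  "to_mod P = mod_translations (virtual P)"

lemma curv_to_mod:
  "curv u v c (to_mod P) = support_fun P (c + axis u 1) + support_fun P (c + axis v 1)
        - support_fun P (c + axis u 1 + axis v 1) - support_fun P c"
  unfolding to_mod_def by (simp add: curv.abs_eq)

lemma to_mod_plus: "to_mod (P + Q) = to_mod P + to_mod Q"
  by (simp add: to_mod_def virtual_plus plus_vpolytope_mod.abs_eq)

lemma to_mod_dilate: "r \<ge> 0 \<Longrightarrow> to_mod (dilate r P) = r *\<^sub>R to_mod P"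
  by (simp add: to_mod_def virtual_dilate scaleR_vpolytope_mod.abs_eq)

lemma to_mod_point: "to_mod (point t) = 0"
  by (simp add: to_mod_def mod_translations_eq_0_iff translation_space_def)

section \<open>Indicator vectors and the set function of a polytope\<close>

definition ind :: "'v::finite set \<Rightarrow> real ^ 'v" where
  "ind S = (\<chi> i. of_bool (i \<in> S))"

lemma ind_nth [simp]: "ind S $ i = of_bool (i \<in> S)"
  by (simp add: ind_def)

lemma ind_empty [simp]: "ind {} = 0"
  by (simp add: vec_eq_iff)

lemma ind_insert: "v \<notin> S \<Longrightarrow> ind (insert v S) = ind S + axis v 1"
  by (auto simp: vec_eq_iff axis_def)

lemma curv_ind_to_mod:
  assumes "u \<noteq> v" "u \<notin> S" "v \<notin> S"
  shows "curv u v (ind S) (to_mod P) = support_fun P (ind (insert u S)) + support_fun P (ind (insert v S))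
        - support_fun P (ind (insert u (insert v S))) - support_fun P (ind S)"
  using assms by (simp add: curv_to_mod ind_insert ac_simps)

lemma support_fun_simplex_on_ind:
  assumes "A \<noteq> {}" shows "support_fun (simplex_on A) (ind S) = of_bool (S \<inter> A \<noteq> {})"
proof -
  have "Max ((\<lambda>v. ind S $ v) ` A) = (of_bool (S \<inter> A \<noteq> {}) :: real)"
    using assms by (intro Max_eqI) (auto simp: image_iff)
  then show ?thesis using assms by (simp add: support_fun_simplex_on)
qed

text \<open>The set function of the simplex is 1 on sets meeting \<open>A\<close> and 0 on the
  others. If \<open>S\<close> meets \<open>A\<close>, the four terms cancel; otherwise they sum to 1
  exactly when both \<open>u\<close> and \<open>v\<close> lie in \<open>A\<close>.\<close>

lemma curv_simplex_on:
  assumes "A \<noteq> {}" "u \<noteq> v" "u \<notin> S" "v \<notin> S"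
  shows "curv u v (ind S) (to_mod (simplex_on A)) = of_bool (u \<in> A \<and> v \<in> A \<and> S \<inter> A = {})"
  using assms by (auto simp: curv_ind_to_mod support_fun_simplex_on_ind)

section \<open>Weak Minkowski summands\<close>

lemma weak_minkowski_summand_add:
  assumes "weak_minkowski_summand P R" "weak_minkowski_summand Q R"
  shows "weak_minkowski_summand (P + Q) R"
proof -
  obtain a P' b Q' where *: "a \<ge> 0" "b \<ge> 0" "P + P' = dilate a R" "Q + Q' = dilate b R"
    using assms unfolding weak_minkowski_summand_def by blast
  have "(P + Q) + (P' + Q') = (P + P') + (Q + Q')" by (simp only: ac_simps)
  then have "(P + Q) + (P' + Q') = dilate (a + b) R" by (simp add: * dilate_add)
  then show ?thesis using *(1,2) unfolding weak_minkowski_summand_def by (meson add_nonneg_nonneg)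
qed

lemma weak_minkowski_summand_dilate:
  assumes "weak_minkowski_summand P R" "r \<ge> 0"
  shows "weak_minkowski_summand (dilate r P) R"
proof -
  obtain a P' where *: "a \<ge> 0" "P + P' = dilate a R"
    using assms unfolding weak_minkowski_summand_def by blast
  have "dilate r P + dilate r P' = dilate (r * a) R"
    by (metis *(2) dilate_dilate dilate_plus)
  then show ?thesis using *(1) assms(2) unfolding weak_minkowski_summand_def by (meson mult_nonneg_nonneg)
qed

lemma weak_minkowski_summand_plus_left: "weak_minkowski_summand P (P + Q)"
  unfolding weak_minkowski_summand_def by (metis dilate_1 zero_le_one)

lemma weak_minkowski_summand_point: "weak_minkowski_summand (point t) R"
proof -
  have "R = point t + (point (- t) + R)"
    by (simp add: add.assoc[symmetric] point_plus[symmetric] point_0)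
  then show ?thesis by (metis weak_minkowski_summand_plus_left)
qed

lemma mod_deformation_cone_eq:
  "mod_translations ` deformation_cone R = to_mod ` {P. weak_minkowski_summand P R}"
  by (simp add: deformation_cone_def to_mod_def image_image)

lemma convex_cone_mod_deformation_cone: "convex_cone (mod_translations ` deformation_cone R)"
  unfolding convex_cone_iff mod_deformation_cone_eq
proof (intro conjI ballI allI impI)
  show "0 \<in> to_mod ` {P. weak_minkowski_summand P R}"
    using weak_minkowski_summand_point[of 0 R] to_mod_point[of 0] by (metis imageI mem_Collect_eq)
next
  fix x y assume "x \<in> to_mod ` {P. weak_minkowski_summand P R}" "y \<in> to_mod ` {P. weak_minkowski_summand P R}"
  then show "x + y \<in> to_mod ` {P. weak_minkowski_summand P R}"
    by (auto simp: to_mod_plus[symmetric] intro!: imageI weak_minkowski_summand_add)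
next
  fix x and c :: real assume "x \<in> to_mod ` {P. weak_minkowski_summand P R}" "0 \<le> c"
  then show "c *\<^sub>R x \<in> to_mod ` {P. weak_minkowski_summand P R}"
    by (auto simp: to_mod_dilate[symmetric] intro!: imageI weak_minkowski_summand_dilate)
qed

text \<open>If \<open>P + Q = c R\<close>, the support functions of \<open>P\<close> and \<open>Q\<close> are both subadditive, so equality
  for their sum forces equality for each.\<close>
lemma weak_minkowski_summand_additive:
  assumes "weak_minkowski_summand P R"
    and "support_fun R (a + b) = support_fun R a + support_fun R b"
  shows "support_fun P (a + b) = support_fun P a + support_fun P b"
proof -
  obtain r Q where r: "r \<ge> 0" and "P + Q = dilate r R"
    using assms unfolding weak_minkowski_summand_def by blast
  then have eq: "support_fun P c + support_fun Q c = r * support_fun R c" for c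
    by (metis support_fun_dilate support_fun_plus)
  show ?thesis
    using support_fun_subadditive[of P a b] support_fun_subadditive[of Q a b]
      eq[of "a + b"] eq[of a] eq[of b] assms(2) by (simp add: algebra_simps)
qed

section \<open>Deformations of a graphical zonotope\<close>

context
  fixes E :: "'v::finite set set"
  assumes E: "simple_graph E"
begin

lemma edgeE:
  assumes "e \<in> E" obtains u v where "e = {u, v}" "u \<noteq> v"
  using assms E unfolding simple_graph_def by (meson card_2_iff)

text \<open>The support function of a segment is the larger of two coordinates, which is additive on
  vectors that order these coordinates compatibly.\<close>

lemma support_fun_graphical_zonotope_additive:
  assumes "\<And>i j. {i, j} \<in> E \<Longrightarrow> (a $ i - a $ j) * (b $ i - b $ j) \<ge> 0"
  shows "support_fun (graphical_zonotope E) (a + b)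
    = support_fun (graphical_zonotope E) a + support_fun (graphical_zonotope E) b"
proof -
  have "support_fun (simplex_on e) (a + b) = support_fun (simplex_on e) a + support_fun (simplex_on e) b"
    if edge: "e \<in> E" for e
  proof -
    obtain u v where e: "e = {u, v}" "u \<noteq> v" using edge by (rule edgeE)
    then have "(a $ u - a $ v) * (b $ u - b $ v) \<ge> 0" using assms edge by blast
    then show ?thesis
      by (auto simp: e(1) support_fun_simplex_on zero_le_mult_iff max_def)
  qed
  then show ?thesis
    by (simp add: graphical_zonotope_eq_sum[OF E] support_fun_sum sum.distrib)
qed

lemma deformation_additive:
  assumes "weak_minkowski_summand P (graphical_zonotope E)"
    and "\<And>i j. {i, j} \<in> E \<Longrightarrow> (a $ i - a $ j) * (b $ i - b $ j) \<ge> 0"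
  shows "support_fun P (a + b) = support_fun P a + support_fun P b"
  using weak_minkowski_summand_additive[OF assms(1)] support_fun_graphical_zonotope_additive[OF assms(2)]
  by blast

abbreviation mod_def_cone where "mod_def_cone \<equiv> mod_translations ` deformation_cone (graphical_zonotope E)"

lemma mod_def_coneE:
  assumes "x \<in> mod_def_cone"
  obtains P where "weak_minkowski_summand P (graphical_zonotope E)" "x = to_mod P"
  using assms by (auto simp: mod_deformation_cone_eq)

text \<open>The nested sets \<open>S\<close> and \<open>S + u + v\<close> have comonotone
  indicators, so the support function is additive on them. Subadditivity on the indicators of
  \<open>S + u\<close> and \<open>S + v\<close>, which have the same sum, then gives
  submodularity.\<close>

lemma curv_nonneg:
  assumes "x \<in> mod_def_cone" "u \<noteq> v" "u \<notin> S" "v \<notin> S"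
  shows "curv u v (ind S) x \<ge> 0"
proof -
  obtain P where P: "weak_minkowski_summand P (graphical_zonotope E)" "x = to_mod P"
    using assms(1) by (rule mod_def_coneE)
  have "support_fun P (ind (insert u (insert v S)) + ind S)
      = support_fun P (ind (insert u (insert v S))) + support_fun P (ind S)"
    by (rule deformation_additive[OF P(1)]) auto
  moreover have "ind (insert u (insert v S)) + ind S = ind (insert u S) + ind (insert v S)"
    using assms(2-4) by (simp add: ind_insert)
  ultimately show ?thesis
    using support_fun_subadditive[of P "ind (insert u S)" "ind (insert v S)"]
    by (simp add: P(2) curv_ind_to_mod assms)
qed

text \<open>The indicators of \<open>S + u\<close> and \<open>S + v\<close> are oppositely ordered
  only at the pair \<open>u, v\<close>. As this is not an edge, additivity holds for them too and
  submodularity becomes an equality.\<close>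

lemma curv_non_edge:
  assumes "x \<in> mod_def_cone" "u \<noteq> v" "u \<notin> S" "v \<notin> S" "{u, v} \<notin> E"
  shows "curv u v (ind S) x = 0"
proof -
  obtain P where P: "weak_minkowski_summand P (graphical_zonotope E)" "x = to_mod P"
    using assms(1) by (rule mod_def_coneE)
  have "support_fun P (ind (insert u (insert v S)) + ind S)
      = support_fun P (ind (insert u (insert v S))) + support_fun P (ind S)"
    by (rule deformation_additive[OF P(1)]) auto
  moreover have "support_fun P (ind (insert u S) + ind (insert v S))
      = support_fun P (ind (insert u S)) + support_fun P (ind (insert v S))"
    by (rule deformation_additive[OF P(1)]) (use assms in \<open>auto simp: insert_commute\<close>)
  moreover have "ind (insert u (insert v S)) + ind S = ind (insert u S) + ind (insert v S)"
    using assms(2-4) by (simp add: ind_insert)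
  ultimately show ?thesis
    by (simp add: P(2) curv_ind_to_mod assms)
qed

text \<open>A comonotone additive function is determined by its values on indicator vectors: peel off
  multiples of the indicator vector of the support (the Lovasz extension).\<close>
lemma deformation_eqI_ind:
  assumes P: "weak_minkowski_summand P (graphical_zonotope E)"
    and Q: "weak_minkowski_summand Q (graphical_zonotope E)"
    and eq: "\<And>S. support_fun P (ind S) = support_fun Q (ind S)"
  shows "P = Q"
proof (rule support_fun_inject)
  fix c :: "real ^ 'v"
  have nonneg: "support_fun P c = support_fun Q c" if "\<And>i. c $ i \<ge> 0" for c
    using that
  proof (induction "card {i. c $ i > 0}" arbitrary: c rule: less_induct)
    case less
    let ?T = "{i. c $ i > 0}"
    show ?case
    proof (cases "?T = {}")
      case True
      then have "c = ind {}" using less.prems by (auto simp: vec_eq_iff antisym_conv1)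
      then show ?thesis using eq by metis
    next
      case False
      \<comment> \<open>Subtracting the least positive coordinate on the support keeps the vector
        nonnegative and kills coordinate \<open>k\<close>, so the induction measure drops.\<close>
      define m where "m = Min ((\<lambda>i. c $ i) ` ?T)"
      have "m \<in> (\<lambda>i. c $ i) ` ?T" unfolding m_def using False by simp
      then obtain k where k: "c $ k = m" "m > 0" by auto
      have m: "m \<le> c $ i" if "c $ i > 0" for i
        unfolding m_def using that by simp
      define d where "d = c - m *\<^sub>R ind ?T"
      have c: "c = m *\<^sub>R ind ?T + d" by (simp add: d_def)
      have d: "d $ i \<ge> 0" for i using m[of i] less.prems[of i] by (simp add: d_def)
      have "{i. d $ i > 0} \<subset> ?T"
      proof
        show "{i. d $ i > 0} \<subseteq> ?T" using less.prems by (auto simp: d_def split: if_splits)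
        have "k \<in> ?T" "k \<notin> {i. d $ i > 0}" using k by (auto simp: d_def)
        then show "{i. d $ i > 0} \<noteq> ?T" by blast
      qed
      then have IH: "support_fun P d = support_fun Q d"
        using less.hyps[of d] d by (simp add: psubset_card_mono)
      \<comment> \<open>Off the support both vectors vanish; on it the first is constant and the
        second nonnegative.\<close>
      have com: "((m *\<^sub>R ind ?T) $ i - (m *\<^sub>R ind ?T) $ j) * (d $ i - d $ j) \<ge> 0" for i j
        using k(2) d[of i] d[of j] less.prems[of i] less.prems[of j]
        by (auto simp: zero_le_mult_iff d_def)
      show ?thesis
        using deformation_additive[OF P com] deformation_additive[OF Q com] IH k(2)
        by (simp add: c[symmetric] support_fun_scaleR eq)
    qed
  qed
  \<comment> \<open>Shifting by \<open>r\<close> makes \<open>c\<close> nonnegative. A constant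
    vector is comonotone with every vector, so the shift can be undone.\<close>
  define r where "r = Max (range (\<lambda>i. \<bar>c $ i\<bar>))"
  have r: "\<bar>c $ i\<bar> \<le> r" for i unfolding r_def by simp
  then have r0: "r \<ge> 0" by (meson abs_ge_zero order_trans)
  have com: "(c $ i - c $ j) * ((r *\<^sub>R ind UNIV) $ i - (r *\<^sub>R ind (UNIV :: 'v set)) $ j) \<ge> 0" for i j
    by simp
  have "support_fun P (c + r *\<^sub>R ind UNIV) = support_fun Q (c + r *\<^sub>R ind UNIV)"
  proof (rule nonneg)
    show "(c + r *\<^sub>R ind UNIV) $ i \<ge> 0" for i using r[of i] by simp
  qed
  then show "support_fun P c = support_fun Q c"
    using deformation_additive[OF P com] deformation_additive[OF Q com] r0
    by (simp add: support_fun_scaleR eq)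
qed

text \<open>A set function with vanishing second differences is modular, hence comes from a translation.\<close>
lemma curv_eqI:
  assumes "x \<in> mod_def_cone" "y \<in> mod_def_cone"
    and eq: "\<And>u v S. u \<noteq> v \<Longrightarrow> u \<notin> S \<Longrightarrow> v \<notin> S \<Longrightarrow> curv u v (ind S) x = curv u v (ind S) y"
  shows "x = y"
proof -
  obtain P where P: "weak_minkowski_summand P (graphical_zonotope E)" "x = to_mod P"
    using assms(1) by (rule mod_def_coneE)
  obtain Q where Q: "weak_minkowski_summand Q (graphical_zonotope E)" "y = to_mod Q"
    using assms(2) by (rule mod_def_coneE)
  define D where "D S = support_fun P (ind S) - support_fun Q (ind S)" for S
  have D0: "D {} = 0"
    using support_fun_scaleR[of 0 P 0] support_fun_scaleR[of 0 Q 0] by (simp add: D_def)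
  have D2: "D (insert u (insert v S)) = D (insert u S) + D (insert v S) - D S"
    if "u \<noteq> v" "u \<notin> S" "v \<notin> S" for u v S
    using eq[OF that] by (simp add: D_def P(2) Q(2) curv_ind_to_mod that)
  \<comment> \<open>With vanishing second differences of \<open>D\<close>, adding \<open>v\<close>
    has the same effect at every set, hence the same as at the empty set.\<close>
  have step: "D (insert v S) = D S + D {v}" if "v \<notin> S" for v S
    using finite[of S] that
  proof (induction S rule: finite_induct)
    case empty
    then show ?case by (simp add: D0)
  next
    case (insert u S)
    then show ?case using D2[of v u S] by auto
  qed
  \<comment> \<open>The singleton values of a modular set function are the coordinates of the
    translation vector.\<close>
  define t where "t = (\<chi> i. D {i})"
  have D: "D S = ind S \<bullet> t" for S
    using finite[of S]
  proof (induction S rule: finite_induct)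
    case empty
    then show ?case by (simp add: D0)
  next
    case (insert v S)
    then show ?case
      by (simp add: step[OF insert.hyps(2)] ind_insert inner_add_left inner_axis' t_def)
  qed
  have "P = Q + point t"
  proof (rule deformation_eqI_ind[OF P(1)])
    show "weak_minkowski_summand (Q + point t) (graphical_zonotope E)"
      by (rule weak_minkowski_summand_add[OF Q(1) weak_minkowski_summand_point])
    show "support_fun P (ind S) = support_fun (Q + point t) (ind S)" for S
      using D[of S] by (simp add: D_def support_fun_plus)
  qed
  then show ?thesis by (simp add: P(2) Q(2) to_mod_plus to_mod_point)
qed

lemma simplex_on_edge_in_mod_def_cone:
  assumes "e \<in> E" shows "to_mod (simplex_on e) \<in> mod_def_cone"
proof -
  have "graphical_zonotope E = simplex_on e + (\<Sum>e\<in>E - {e}. simplex_on e)"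
    using assms by (simp add: graphical_zonotope_eq_sum[OF E] sum.remove)
  then show ?thesis unfolding mod_deformation_cone_eq by (auto intro: weak_minkowski_summand_plus_left)
qed

end

section \<open>Rays of cones\<close>

text \<open>A functional vanishing on \<open>B - {v}\<close> vanishes on its span, which therefore
  misses \<open>v\<close>.\<close>

lemma independent_if_separated:
  assumes "\<And>v. v \<in> B \<Longrightarrow> \<exists>f :: 'a::real_vector \<Rightarrow> real. linear f \<and> f v \<noteq> 0 \<and> (\<forall>w\<in>B - {v}. f w = 0)"
  shows "independent B"
proof
  assume "dependent B"
  then obtain v where v: "v \<in> B" "v \<in> span (B - {v})" unfolding dependent_def by blast
  then obtain f :: "'a \<Rightarrow> real" where f: "linear f" "f v \<noteq> 0" "\<And>w. w \<in> B - {v} \<Longrightarrow> f w = 0"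
    using assms by blast
  show False
    using linear_eq_0_on_span[OF f(1,3) v(2)] f(2) by blast
qed

definition half_line :: "'a::real_vector \<Rightarrow> 'a set" where
  "half_line v = {c *\<^sub>R v | c. c \<ge> 0}"

lemma half_line_self: "v \<in> half_line v"
  unfolding half_line_def by (force intro: exI[of _ 1])

lemma cone_rays_iff: "F \<in> cone_rays C \<longleftrightarrow> F face_of C \<and> (\<exists>v. v \<noteq> 0 \<and> F = half_line v)"
  by (simp add: cone_rays_def half_line_def)

lemma half_line_eqI:
  assumes "w \<in> half_line v" "w \<noteq> 0" shows "half_line w = half_line v"
proof -
  obtain c where c: "w = c *\<^sub>R v" "c \<ge> 0" using assms(1) unfolding half_line_def by blast
  then have "c > 0" using assms(2) by (cases "c = 0") auto
  have "r *\<^sub>R v \<in> half_line w" if "r \<ge> 0" for r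
    unfolding half_line_def using that \<open>c > 0\<close> by (auto simp: c(1) intro!: exI[of _ "r / c"])
  then have "half_line v \<subseteq> half_line w"
    unfolding half_line_def[of v] by blast
  moreover have "r *\<^sub>R w \<in> half_line v" if "r \<ge> 0" for r
    unfolding half_line_def using that c(2) by (auto simp: c(1) intro!: exI[of _ "r * c"])
  then have "half_line w \<subseteq> half_line v"
    unfolding half_line_def[of w] by blast
  ultimately show ?thesis by blast
qed

text \<open>The two scaled terms of a convex combination are summands inside the cone, so a vector
  with only trivial decompositions spans a face.\<close>

lemma indecomposable_half_line_in_cone_rays:
  assumes C: "convex_cone C" and v: "v \<in> C" "v \<noteq> 0"
    and indec: "\<And>x y. x \<in> C \<Longrightarrow> y \<in> C \<Longrightarrow> x + y = v \<Longrightarrow> x \<in> half_line v"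
  shows "half_line v \<in> cone_rays C"
proof -
  have summand: "x \<in> half_line v" if x: "x \<in> C" and y: "y \<in> C" and sum: "x + y \<in> half_line v" for x y
  proof -
    obtain c where c: "x + y = c *\<^sub>R v" "c \<ge> 0" using sum unfolding half_line_def by blast
    \<comment> \<open>Adding \<open>v\<close> to the second summand turns the total into
      \<open>(c + 1) *\<^sub>R v\<close>, which can be rescaled to \<open>v\<close> even if
      \<open>c = 0\<close>.\<close>
    define d where "d = 1 / (c + 1)"
    have d: "d > 0" "d * (c + 1) = 1" using c(2) by (auto simp: d_def)
    have "d *\<^sub>R x + d *\<^sub>R (y + v) = d *\<^sub>R ((x + y) + v)" by (simp add: scaleR_add_right)
    also have "\<dots> = (d * (c + 1)) *\<^sub>R v" by (simp add: c(1) algebra_simps)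
    also have "\<dots> = v" by (simp add: d(2))
    finally have "d *\<^sub>R x \<in> half_line v"
      by (intro indec[of _ "d *\<^sub>R (y + v)"] convex_cone_scaleR[OF C] convex_cone_add[OF C] x y v)
        (use d in auto)
    then obtain b where b: "b \<ge> 0" "d *\<^sub>R x = b *\<^sub>R v" unfolding half_line_def by blast
    have "x = inverse d *\<^sub>R (d *\<^sub>R x)" using d(1) by simp
    also have "\<dots> = (inverse d * b) *\<^sub>R v" by (simp only: b(2) scaleR_scaleR)
    finally have "x = (inverse d * b) *\<^sub>R v" .
    then show ?thesis using b d unfolding half_line_def by (auto intro!: exI[of _ "inverse d * b"])
  qed
  have "half_line v face_of C"
    unfolding face_of_def
  proof (intro conjI ballI impI)
    show "half_line v \<subseteq> C" unfolding half_line_def using v(1) C by (auto intro: convex_cone_scaleR)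
    show "convex (half_line v)"
    proof (rule convexI)
      fix x y and a b :: real
      assume "x \<in> half_line v" "y \<in> half_line v" and ab: "a \<ge> 0" "b \<ge> 0"
      then obtain c d where "x = c *\<^sub>R v" "y = d *\<^sub>R v" "c \<ge> 0" "d \<ge> 0" unfolding half_line_def by blast
      then show "a *\<^sub>R x + b *\<^sub>R y \<in> half_line v"
        unfolding half_line_def using ab by (auto simp: algebra_simps intro!: exI[of _ "a * c + b * d"])
    qed
    fix a b x assume ab: "a \<in> C" "b \<in> C" and x: "x \<in> half_line v" "x \<in> open_segment a b"
    then obtain u where u: "0 < u" "u < 1" "x = (1 - u) *\<^sub>R a + u *\<^sub>R b"
      unfolding in_segment by blast
    have in_C: "(1 - u) *\<^sub>R a \<in> C" "u *\<^sub>R b \<in> C" using ab u C by (auto intro: convex_cone_scaleR)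
    have unscale: "y \<in> half_line v" if "r > 0" "r *\<^sub>R y \<in> half_line v" for r :: real and y
    proof -
      obtain c where c: "c \<ge> 0" "r *\<^sub>R y = c *\<^sub>R v" using \<open>r *\<^sub>R y \<in> half_line v\<close> unfolding half_line_def by blast
      have "y = inverse r *\<^sub>R (r *\<^sub>R y)" using \<open>r > 0\<close> by simp
      also have "\<dots> = (inverse r * c) *\<^sub>R v" by (simp only: c(2) scaleR_scaleR)
      finally show ?thesis unfolding half_line_def using c \<open>r > 0\<close> by (auto intro!: exI[of _ "inverse r * c"])
    qed
    show "a \<in> half_line v" using unscale[of "1 - u" a] summand[OF in_C] x u by simp
    show "b \<in> half_line v" using unscale[of "u" b] summand[OF in_C(2,1)] x u by (simp add: add.commute)
  qed
  then show ?thesis using v(2) by (auto simp: cone_rays_iff)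
qed

text \<open>Injectivity of \<open>half_line\<close> on \<open>X\<close> allows a choice of one
  generator for each ray that contains all of \<open>X\<close>.\<close>

lemma independent_rays_imp_independent:
  assumes "independent_rays C"
    and X: "\<And>v. v \<in> X \<Longrightarrow> v \<noteq> 0 \<and> half_line v \<in> cone_rays C" and inj: "inj_on half_line X"
  shows "independent X"
proof -
  define g where "g F = (if F \<in> half_line ` X then inv_into X half_line F else SOME v. v \<in> F \<and> v \<noteq> 0)" for F
  have gX: "g (half_line v) = v" if "v \<in> X" for v
    using that inj by (simp add: g_def)
  have "g F \<in> F \<and> g F \<noteq> 0" if "F \<in> cone_rays C" for F
  proof (cases "F \<in> half_line ` X")
    case True
    then show ?thesis using gX X half_line_self by force
  next
    case False
    have "\<exists>v. v \<in> F \<and> v \<noteq> 0" using that half_line_self by (auto simp: cone_rays_iff)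
    then show ?thesis using False by (simp add: g_def) (metis (mono_tags, lifting) someI_ex)
  qed
  then have "independent (g ` cone_rays C)" using assms(1) unfolding independent_rays_def by blast
  moreover have "X \<subseteq> g ` cone_rays C" using gX X by force
  ultimately show ?thesis by (rule independent_mono)
qed

text \<open>The functionals \<open>\<phi> i\<close> are coordinates with respect to the generators
  \<open>\<sigma> i\<close>, and \<open>C\<close> is the orthant of nonnegative coordinates.\<close>

lemma simplicial_cone_dual_basisI:
  fixes \<phi> :: "'i \<Rightarrow> 'a::real_vector \<Rightarrow> real"
  assumes I: "finite I" and C: "convex_cone C" and lin: "\<And>i. i \<in> I \<Longrightarrow> linear (\<phi> i)"
    and \<sigma>: "\<And>i. i \<in> I \<Longrightarrow> \<sigma> i \<in> C"
    and dual: "\<And>i j. i \<in> I \<Longrightarrow> j \<in> I \<Longrightarrow> \<phi> i (\<sigma> j) = of_bool (i = j)"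
    and nonneg: "\<And>i x. i \<in> I \<Longrightarrow> x \<in> C \<Longrightarrow> \<phi> i x \<ge> 0"
    and expand: "\<And>x. x \<in> C \<Longrightarrow> x = (\<Sum>i\<in>I. \<phi> i x *\<^sub>R \<sigma> i)"
  shows "simplicial_cone C"
  unfolding simplicial_cone_def
proof (intro conjI)
  \<comment> \<open>\<open>D\<close> stays general because the sums are placed both in the hull and
    in \<open>C\<close> itself.\<close>
  have sum_in: "(\<Sum>i\<in>J. r i *\<^sub>R \<sigma> i) \<in> D"
    if D: "convex_cone D" "\<sigma> ` I \<subseteq> D" and J: "J \<subseteq> I" "\<And>i. i \<in> J \<Longrightarrow> r i \<ge> 0" for J D and r :: "'i \<Rightarrow> real"
    using finite_subset[OF J(1) I] J
  proof (induction J rule: finite_induct)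
    case empty
    then show ?case using convex_cone_contains_0[OF D(1)] by simp
  next
    case (insert i J)
    then show ?case using D by (auto intro!: convex_cone_add convex_cone_scaleR)
  qed
  have "C = convex_cone hull (\<sigma> ` I)"
  proof
    show "convex_cone hull (\<sigma> ` I) \<subseteq> C" by (rule hull_minimal) (use C \<sigma> in auto)
    show "C \<subseteq> convex_cone hull (\<sigma> ` I)"
    proof
      fix x assume x: "x \<in> C"
      have "(\<Sum>i\<in>I. \<phi> i x *\<^sub>R \<sigma> i) \<in> convex_cone hull (\<sigma> ` I)"
        by (rule sum_in) (use nonneg x in \<open>auto simp: convex_cone_convex_cone_hull hull_inc\<close>)
      then show "x \<in> convex_cone hull (\<sigma> ` I)" using expand[OF x] by simp
    qed
  qed
  then show "polyhedral_cone C" unfolding polyhedral_cone_def using I by blast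
  show "lineality_space C = {0}"
    unfolding lineality_space_def
  proof (rule Greatest_equality)
    show "subspace {0} \<and> {0} \<subseteq> C" using convex_cone_contains_0[OF C] by (simp add: subspace_0)
    fix L assume L: "subspace L \<and> L \<subseteq> C"
    show "L \<le> {0}"
    proof
      fix x assume "x \<in> L"
      then have x: "x \<in> C" "- x \<in> C" using L subspace_neg by blast+
      have "\<phi> i x = 0" if "i \<in> I" for i
        using nonneg[OF that x(1)] nonneg[OF that x(2)] by (simp add: linear_neg[OF lin[OF that]])
      then show "x \<in> {0}" using expand[OF x(1)] by simp
    qed
  qed
  \<comment> \<open>Split a spanning vector of the ray into the part along one positive coordinate
    and the rest; the face property puts that part on the ray.\<close>
  have ray: "\<exists>i\<in>I. F = half_line (\<sigma> i)" if F: "F \<in> cone_rays C" for F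
  proof -
    obtain v where face: "F face_of C" and v: "v \<noteq> 0" "F = half_line v"
      using F by (auto simp: cone_rays_iff)
    then have vC: "v \<in> C" using half_line_self face_of_imp_subset by blast
    have "\<exists>i\<in>I. \<phi> i v \<noteq> 0" using expand[OF vC] v(1) by (metis (no_types, lifting) scaleR_zero_left sum.neutral)
    then obtain i where i: "i \<in> I" "\<phi> i v > 0" using nonneg vC by force
    \<comment> \<open>The factor 2 makes \<open>v\<close> the midpoint of \<open>a\<close> and
      \<open>b\<close>.\<close>
    define a where "a = (2 * \<phi> i v) *\<^sub>R \<sigma> i"
    define b where "b = (\<Sum>j\<in>I - {i}. (2 * \<phi> j v) *\<^sub>R \<sigma> j)"
    have aC: "a \<in> C" unfolding a_def using C \<sigma> i by (auto intro: convex_cone_scaleR)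
    have bC: "b \<in> C" unfolding b_def by (rule sum_in) (use C \<sigma> nonneg vC in auto)
    have "a + b = (\<Sum>j\<in>I. (2 * \<phi> j v) *\<^sub>R \<sigma> j)"
      unfolding a_def b_def using I i(1) by (simp add: sum.remove)
    also have "\<dots> = 2 *\<^sub>R (\<Sum>j\<in>I. \<phi> j v *\<^sub>R \<sigma> j)" by (simp add: scaleR_sum_right)
    also have "\<dots> = 2 *\<^sub>R v" using expand[OF vC] by simp
    finally have ab: "a + b = 2 *\<^sub>R v" .
    have v_eq: "v = (1/2) *\<^sub>R (a + b)" by (simp add: ab)
    \<comment> \<open>If \<open>a = b\<close>, the open segment is empty, but then \<open>a\<close>
      is \<open>v\<close> itself.\<close>
    have "a \<in> F"
    proof (cases "a = b")
      case True
      then have "a = v" by (simp add: v_eq scaleR_add_right flip: scaleR_add_left)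
      then show ?thesis using v(2) half_line_self by simp
    next
      case False
      then have "v \<in> open_segment a b"
        unfolding in_segment by (auto simp: v_eq scaleR_add_right intro!: exI[of _ "1/2"])
      then show ?thesis using face_ofD[OF face _ aC bC] v(2) half_line_self by blast
    qed
    moreover have "\<phi> i a \<noteq> 0"
      using i by (simp add: a_def linear_cmul[OF lin[OF i(1)]] dual)
    then have "a \<noteq> 0" using linear_0[OF lin[OF i(1)]] by metis
    moreover have "a \<in> half_line (\<sigma> i)" unfolding a_def half_line_def using i(2)
      by (auto intro!: exI[of _ "2 * \<phi> i v"])
    ultimately have "F = half_line (\<sigma> i)" using half_line_eqI v(2) by metis
    then show ?thesis using i(1) by blast
  qed
  show "independent_rays C"
    unfolding independent_rays_def
  proof (intro allI impI)
    fix g assume g: "\<forall>F\<in>cone_rays C. g F \<in> F \<and> g F \<noteq> 0"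
    have coeff: "\<exists>c. c \<noteq> 0 \<and> g F = c *\<^sub>R \<sigma> i" if "F \<in> cone_rays C" "F = half_line (\<sigma> i)" for F i
    proof -
      have "g F \<in> half_line (\<sigma> i)" "g F \<noteq> 0" using g that by auto
      then show ?thesis unfolding half_line_def by force
    qed
    show "independent (g ` cone_rays C)"
    proof (rule independent_if_separated)
      fix v assume "v \<in> g ` cone_rays C"
      then obtain F where F: "F \<in> cone_rays C" "v = g F" by blast
      then obtain i where i: "i \<in> I" "F = half_line (\<sigma> i)" using ray by blast
      have "\<phi> i v \<noteq> 0"
        using coeff[OF F(1) i(2)] F(2) by (auto simp: linear_cmul[OF lin[OF i(1)]] dual i(1))
      moreover have "\<phi> i w = 0" if w: "w \<in> g ` cone_rays C - {v}" for w
      proof -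
        obtain F' where F': "F' \<in> cone_rays C" "w = g F'" using w by blast
        then obtain j where j: "j \<in> I" "F' = half_line (\<sigma> j)" using ray by blast
        have "i \<noteq> j" using F F' i j w by auto
        then show ?thesis
          using coeff[OF F'(1) j(2)] F'(2) by (auto simp: linear_cmul[OF lin[OF i(1)]] dual i(1) j(1))
      qed
      ultimately show "\<exists>f :: _ \<Rightarrow> real. linear f \<and> f v \<noteq> 0 \<and> (\<forall>w\<in>g ` cone_rays C - {v}. f w = 0)"
        using lin[OF i(1)] by blast
    qed
  qed
qed

section \<open>Triangle-free graphs\<close>

lemma triangle_freeD:
  assumes "triangle_free E" "{u, v} \<in> E" "{u, w} \<in> E" shows "{v, w} \<notin> E"
  using assms unfolding triangle_free_def by (metis insert_commute)

lemma curv_insert: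
  assumes "w \<notin> S" "v \<notin> S"
  shows "curv u v (ind (insert w S)) x - curv u v (ind S) x
    = curv u w (ind (insert v S)) x - curv u w (ind S) x"
  using curv_third_difference[of u v "ind S" w x] assms by (simp add: ind_insert)

text \<open>Add the vertices of \<open>S - S0\<close> one at a time. Adding \<open>w\<close> changes
  the second difference at \<open>u, v\<close> by a third difference, which is also a change at
  \<open>u, w\<close> and at \<open>v, w\<close>; at one of these pairs all values vanish.\<close>

lemma curv_const:
  assumes "S0 \<subseteq> S" "u \<notin> S" "v \<notin> S"
    and "\<And>w. w \<in> S - S0 \<Longrightarrow>
      (\<forall>S'. u \<notin> S' \<longrightarrow> w \<notin> S' \<longrightarrow> curv u w (ind S') x = 0) \<or>
      (\<forall>S'. v \<notin> S' \<longrightarrow> w \<notin> S' \<longrightarrow> curv v w (ind S') x = 0)"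
    and "u \<noteq> v"
  shows "curv u v (ind S) x = curv u v (ind S0) x"
proof -
  have "curv u v (ind (F \<union> S0)) x = curv u v (ind S0) x" if "F \<subseteq> S - S0" for F
    using finite[of F] that
  proof (induction F rule: finite_subset_induct')
    case (insert w F)
    let ?S = "F \<union> S0"
    have *: "w \<in> S - S0" "w \<notin> ?S" "u \<notin> ?S" "v \<notin> ?S" "w \<noteq> u" "w \<noteq> v"
      using insert.hyps assms(1-3) by auto
    have "curv u v (ind (insert w ?S)) x = curv u v (ind ?S) x"
      using assms(4)[OF *(1)] curv_insert[of w ?S u v x] curv_insert[of w ?S v u x] * assms(5)
      by (auto simp: curv_commute[of v u])
    then show ?case using insert.IH by simp
  qed simp
  from this[of "S - S0"] show ?thesis using assms(1) by (simp add: Un_absorb2)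
qed

text \<open>If \<open>{u, v} = {p, q}\<close>, then \<open>S\<close> misses the edge, so the value
  does not depend on \<open>S\<close>.\<close>

lemma curv_to_mod_edge:
  assumes "u \<noteq> v" "u \<notin> S" "v \<notin> S" "p \<noteq> q"
  shows "curv u v (ind S) (to_mod (simplex_on {p, q})) = of_bool ({u, v} = {p, q})"
  using assms by (auto simp: curv_simplex_on doubleton_eq_iff)

text \<open>The second differences at the empty set, one for each edge, are dual to the classes of
  the segments.\<close>

lemma simplicial_if_triangle_free:
  fixes E :: "'v::finite set set"
  assumes E: "simple_graph E" and free: "triangle_free E"
  shows "simplicial_cone (mod_def_cone E)"
proof -
  have "\<forall>e\<in>E. \<exists>u v. e = {u, v} \<and> u \<noteq> v" using edgeE[OF E] by metis
  then obtain p q where pq: "\<And>e. e \<in> E \<Longrightarrow> e = {p e, q e}" "\<And>e. e \<in> E \<Longrightarrow> p e \<noteq> q e" by metis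
  define \<phi> where "\<phi> e = curv (p e) (q e) (0 :: real ^ 'v)" for e
  define \<sigma> where "\<sigma> e = to_mod (simplex_on e :: (real ^ 'v) npolytope)" for e
  have lin: "linear (\<phi> e)" for e unfolding \<phi>_def by (rule linear_curv)
  have curv_\<sigma>: "curv u v (ind S) (\<sigma> e) = of_bool ({u, v} = e)"
    if "e \<in> E" "u \<noteq> v" "u \<notin> S" "v \<notin> S" for e u v S
    using curv_to_mod_edge[OF that(2-4) pq(2)[OF that(1)]] pq(1)[OF that(1)] by (simp add: \<sigma>_def)
  have \<sigma>_in: "\<sigma> e \<in> mod_def_cone E" if "e \<in> E" for e
    unfolding \<sigma>_def using simplex_on_edge_in_mod_def_cone[OF E that] .
  have nonneg: "\<phi> e x \<ge> 0" if "e \<in> E" "x \<in> mod_def_cone E" for e x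
    using curv_nonneg[OF E that(2) pq(2)[OF that(1)], of "{}"] by (simp add: \<phi>_def)
  note cone = convex_cone_mod_deformation_cone[of "graphical_zonotope E"]
  show ?thesis
  proof (rule simplicial_cone_dual_basisI[where I = E and \<phi> = \<phi> and \<sigma> = \<sigma>])
    show "\<phi> e (\<sigma> e') = of_bool (e = e')" if "e \<in> E" "e' \<in> E" for e e'
      using curv_\<sigma>[OF that(2) pq(2)[OF that(1)], of "{}"] pq(1)[OF that(1)] by (simp add: \<phi>_def)
    fix x assume x: "x \<in> mod_def_cone E"
    have sum_in: "(\<Sum>e\<in>F. \<phi> e x *\<^sub>R \<sigma> e) \<in> mod_def_cone E" if "F \<subseteq> E" for F
      using finite[of F] that
    proof (induction F rule: finite_induct)
      case empty
      then show ?case using convex_cone_contains_0[OF cone] by simp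
    next
      case (insert e F)
      then show ?case
        using convex_cone_add[OF cone convex_cone_scaleR[OF cone nonneg[OF _ x] \<sigma>_in]] by simp
    qed
    \<comment> \<open>Both sides lie in the cone, so it suffices to compare second
      differences.\<close>
    show "x = (\<Sum>e\<in>E. \<phi> e x *\<^sub>R \<sigma> e)"
    proof (rule curv_eqI[OF E x sum_in[OF order_refl]])
      fix u v :: 'v and S assume uv: "u \<noteq> v" "u \<notin> S" "v \<notin> S"
      have "curv u v (ind S) (\<Sum>e\<in>E. \<phi> e x *\<^sub>R \<sigma> e) = (\<Sum>e\<in>E. \<phi> e x * of_bool ({u, v} = e))"
        using uv by (simp add: linear_sum[OF linear_curv] curv_scaleR curv_\<sigma>)
      also have "\<dots> = (if {u, v} \<in> E then \<phi> {u, v} x else 0)"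
        by (simp add: of_bool_def if_distrib cong: if_cong)
      also have "\<dots> = curv u v (ind S) x"
      proof (cases "{u, v} \<in> E")
        case True
        \<comment> \<open>Since \<open>{u, v}\<close> is an edge, each \<open>w\<close> in
          \<open>S\<close> is non-adjacent to \<open>u\<close> or to \<open>v\<close>, and
          \<open>curv_const\<close> reduces \<open>S\<close> to the empty set.\<close>
        have "curv u v (ind S) x = curv u v 0 x"
          using triangle_freeD[OF free True] uv
          by (intro curv_const[of "{}" S u v x, simplified]) (metis curv_non_edge[OF E x])+
        moreover have "\<phi> {u, v} x = curv u v 0 x"
          using pq[OF True] by (auto simp: \<phi>_def doubleton_eq_iff curv_commute)
        ultimately show ?thesis using True by simp
      qed (simp add: curv_non_edge[OF E x uv])
      finally show "curv u v (ind S) x = curv u v (ind S) (\<Sum>e\<in>E. \<phi> e x *\<^sub>R \<sigma> e)" by simp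
    qed
  qed (use lin \<sigma>_in nonneg cone in auto)
qed

section \<open>Triangles\<close>

text \<open>In a decomposition of \<open>z\<close>, nonnegativity makes the second differences of
  both parts vanish wherever those of \<open>z\<close> do. If this pattern fixes an element of the
  cone up to a factor, \<open>z\<close> is indecomposable.\<close>

lemma rigid_imp_ray:
  fixes E :: "'v::finite set set"
  assumes E: "simple_graph E" and z: "z \<in> mod_def_cone E" "z \<noteq> 0"
    and rigid: "\<And>x. x \<in> mod_def_cone E \<Longrightarrow>
      (\<And>u v S. u \<noteq> v \<Longrightarrow> u \<notin> S \<Longrightarrow> v \<notin> S \<Longrightarrow> curv u v (ind S) z = 0 \<Longrightarrow> curv u v (ind S) x = 0) \<Longrightarrow>
      \<exists>r\<ge>0. \<forall>u v S. u \<noteq> v \<longrightarrow> u \<notin> S \<longrightarrow> v \<notin> S \<longrightarrow> curv u v (ind S) x = r * curv u v (ind S) z"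
  shows "half_line z \<in> cone_rays (mod_def_cone E)"
proof (rule indecomposable_half_line_in_cone_rays[OF convex_cone_mod_deformation_cone z])
  fix x y assume xy: "x \<in> mod_def_cone E" "y \<in> mod_def_cone E" "x + y = z"
  have zero: "curv u v (ind S) x = 0" if "u \<noteq> v" "u \<notin> S" "v \<notin> S" "curv u v (ind S) z = 0" for u v S
    using curv_nonneg[OF E xy(1) that(1-3)] curv_nonneg[OF E xy(2) that(1-3)] that(4)
    by (simp add: xy(3)[symmetric] curv_add)
  have "\<exists>r\<ge>0. \<forall>u v S. u \<noteq> v \<longrightarrow> u \<notin> S \<longrightarrow> v \<notin> S \<longrightarrow> curv u v (ind S) x = r * curv u v (ind S) z"
    by (rule rigid[OF xy(1)]) (rule zero)
  then obtain r where r: "r \<ge> 0"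
    "\<And>u v S. u \<noteq> v \<Longrightarrow> u \<notin> S \<Longrightarrow> v \<notin> S \<Longrightarrow> curv u v (ind S) x = r * curv u v (ind S) z" by metis
  have "x = r *\<^sub>R z"
    by (rule curv_eqI[OF E xy(1) convex_cone_scaleR[OF convex_cone_mod_deformation_cone r(1) z(1)]])
      (simp add: curv_scaleR r(2))
  then show "x \<in> half_line z" unfolding half_line_def using r(1) by blast
qed

context
  fixes E :: "'v::finite set set" and a b c :: 'v
  assumes E: "simple_graph E" and abc: "{a, b} \<in> E" "{b, c} \<in> E" "{a, c} \<in> E"
begin

lemma distinct_abc: "a \<noteq> b" "b \<noteq> c" "a \<noteq> c"
  using E abc unfolding simple_graph_def by fastforce+

text \<open>A translate of the point reflection of the triangle, chosen so that the hexagon relation below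
  needs no translation.\<close>
definition reversed_triangle :: "(real ^ 'v) npolytope" where
  "reversed_triangle = hull_polytope {axis a 1 + axis b 1, axis b 1 + axis c 1, axis a 1 + axis c 1}"

text \<open>If the coordinates of the direction at the three vertices are
  \<open>x \<ge> y \<ge> z\<close> in some order, both sides have the value
  \<open>2 * x + y\<close>: the triangles give \<open>x\<close> and \<open>x + y\<close>, the
  segments \<open>x\<close>, \<open>x\<close> and \<open>y\<close>.\<close>

lemma triangle_plus_reversed_triangle:
  "simplex_on {a, b, c} + reversed_triangle = simplex_on {a, b} + simplex_on {b, c} + simplex_on {a, c}"
proof (rule support_fun_inject)
  fix k :: "real ^ 'v"
  have "support_fun reversed_triangle k = max (k $ a + k $ b) (max (k $ b + k $ c) (k $ a + k $ c))"
    unfolding reversed_triangle_def by (simp add: support_fun_hull_polytope inner_add_right inner_axis)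
  then show "support_fun (simplex_on {a, b, c} + reversed_triangle) k
      = support_fun (simplex_on {a, b} + simplex_on {b, c} + simplex_on {a, c}) k"
    by (simp add: support_fun_plus support_fun_simplex_on)
qed

text \<open>The three segments of the triangle sum to a hexagon that is a summand of the zonotope
  and also splits into the two triangles.\<close>

lemma triangle_summand:
  "to_mod (simplex_on {a, b, c}) \<in> mod_def_cone E" "to_mod reversed_triangle \<in> mod_def_cone E"
proof -
  let ?F = "{{a, b}, {b, c}, {a, c}}"
  have "(\<Sum>e\<in>?F. simplex_on e) = simplex_on {a, b} + simplex_on {b, c} + simplex_on {a, c}"
    using distinct_abc by (simp add: doubleton_eq_iff add.assoc)
  moreover have "graphical_zonotope E = (\<Sum>e\<in>?F. simplex_on e) + (\<Sum>e\<in>E - ?F. simplex_on e)"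
    unfolding graphical_zonotope_eq_sum[OF E]
    by (subst add.commute, rule sum.subset_diff) (use abc in auto)
  ultimately have sum: "graphical_zonotope E
      = (simplex_on {a, b, c} + reversed_triangle) + (\<Sum>e\<in>E - ?F. simplex_on e)"
    by (simp only: triangle_plus_reversed_triangle)
  have "graphical_zonotope E = simplex_on {a, b, c} + (reversed_triangle + (\<Sum>e\<in>E - ?F. simplex_on e))"
    "graphical_zonotope E = reversed_triangle + (simplex_on {a, b, c} + (\<Sum>e\<in>E - ?F. simplex_on e))"
    unfolding sum by (simp_all only: ac_simps)
  then show "to_mod (simplex_on {a, b, c}) \<in> mod_def_cone E" "to_mod reversed_triangle \<in> mod_def_cone E"
    unfolding mod_deformation_cone_eq by (metis imageI mem_Collect_eq weak_minkowski_summand_plus_left)+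
qed

text \<open>By the hexagon relation the reversed triangle takes what the simplex leaves of the
  segments: the sets that meet the triangle.\<close>

lemma curv_reversed_triangle:
  assumes "u \<noteq> v" "u \<notin> S" "v \<notin> S"
  shows "curv u v (ind S) (to_mod reversed_triangle)
    = of_bool (u \<in> {a, b, c} \<and> v \<in> {a, b, c} \<and> S \<inter> {a, b, c} \<noteq> {})"
proof -
  have "curv u v (ind S) (to_mod (simplex_on {a, b, c})) + curv u v (ind S) (to_mod reversed_triangle)
    = curv u v (ind S) (to_mod (simplex_on {a, b})) + curv u v (ind S) (to_mod (simplex_on {b, c}))
      + curv u v (ind S) (to_mod (simplex_on {a, c}))"
    by (simp only: curv_add[symmetric] to_mod_plus[symmetric] triangle_plus_reversed_triangle)
  then show ?thesis
    using assms distinct_abc by (auto simp: curv_simplex_on of_bool_def split: if_splits)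
qed

text \<open>Third differences make the second differences allowed by the pattern independent of
  \<open>S\<close> and equal for the three pairs, so a single coefficient remains.\<close>

lemma triangle_ray: "half_line (to_mod (simplex_on {a, b, c})) \<in> cone_rays (mod_def_cone E)"
proof (rule rigid_imp_ray[OF E triangle_summand(1)])
  let ?T = "{a, b, c}"
  show "to_mod (simplex_on ?T) \<noteq> 0"
    using curv_simplex_on[of ?T a b "{}"] distinct_abc linear_0[OF linear_curv, of a b 0] by auto
  fix x assume x: "x \<in> mod_def_cone E"
    and "\<And>u v S. u \<noteq> v \<Longrightarrow> u \<notin> S \<Longrightarrow> v \<notin> S \<Longrightarrow>
      curv u v (ind S) (to_mod (simplex_on ?T)) = 0 \<Longrightarrow> curv u v (ind S) x = 0"
  then have zero: "curv u v (ind S) x = 0"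
    if "u \<noteq> v" "u \<notin> S" "v \<notin> S" "\<not> (u \<in> ?T \<and> v \<in> ?T \<and> S \<inter> ?T = {})" for u v S
    using that curv_simplex_on[of ?T u v S] by simp
  have const: "curv u v (ind S) x = curv u v 0 x"
    if "u \<noteq> v" "u \<notin> S" "v \<notin> S" "S \<inter> ?T = {}" for u v S
  proof (rule curv_const[of "{}" S u v x, simplified])
    show "(\<forall>S'. u \<notin> S' \<longrightarrow> w \<notin> S' \<longrightarrow> curv u w (ind S') x = 0) \<or>
        (\<forall>S'. v \<notin> S' \<longrightarrow> w \<notin> S' \<longrightarrow> curv v w (ind S') x = 0)" if "w \<in> S" for w
    proof -
      have "u \<noteq> w" "w \<notin> ?T" using \<open>w \<in> S\<close> \<open>u \<notin> S\<close> \<open>S \<inter> ?T = {}\<close> by auto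
      then show ?thesis using zero[of u w] by simp
    qed
  qed (use that in auto)
  \<comment> \<open>Adding the third vertex kills the second difference of a pair, so each change is
    minus the value at the empty set.\<close>
  have "curv a b 0 x = curv a c 0 x" "curv b a 0 x = curv b c 0 x"
    using curv_insert[of c "{}" b a x] curv_insert[of c "{}" a b x]
      zero[of a b "{c}"] zero[of a c "{b}"] zero[of b a "{c}"] zero[of b c "{a}"] distinct_abc
    by auto
  then have eq: "curv u v 0 x = curv a b 0 x" if "u \<in> ?T" "v \<in> ?T" "u \<noteq> v" for u v
    using that by (auto simp: curv_commute)
  show "\<exists>r\<ge>0. \<forall>u v S. u \<noteq> v \<longrightarrow> u \<notin> S \<longrightarrow> v \<notin> S \<longrightarrow>
      curv u v (ind S) x = r * curv u v (ind S) (to_mod (simplex_on ?T))"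
  proof (intro exI[of _ "curv a b 0 x"] conjI allI impI)
    show "curv a b 0 x \<ge> 0"
      using curv_nonneg[OF E x, of a b "{}"] distinct_abc by simp
    fix u v :: 'v and S assume uv: "u \<noteq> v" "u \<notin> S" "v \<notin> S"
    then show "curv u v (ind S) x = curv a b 0 x * curv u v (ind S) (to_mod (simplex_on ?T))"
      using zero[OF uv] const[OF uv] eq[of u v] curv_simplex_on[of ?T u v S]
      by (cases "u \<in> ?T \<and> v \<in> ?T \<and> S \<inter> ?T = {}") auto
  qed
qed

text \<open>The argument for the simplex, with sets missing the triangle and sets meeting it
  exchanged.\<close>

lemma reversed_triangle_ray: "half_line (to_mod reversed_triangle) \<in> cone_rays (mod_def_cone E)"
proof (rule rigid_imp_ray[OF E triangle_summand(2)])
  let ?T = "{a, b, c}"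
  show "to_mod reversed_triangle \<noteq> 0"
    using curv_reversed_triangle[of a b "{c}"] distinct_abc linear_0[OF linear_curv, of a b "ind {c}"]
    by auto
  fix x assume x: "x \<in> mod_def_cone E"
    and "\<And>u v S. u \<noteq> v \<Longrightarrow> u \<notin> S \<Longrightarrow> v \<notin> S \<Longrightarrow>
      curv u v (ind S) (to_mod reversed_triangle) = 0 \<Longrightarrow> curv u v (ind S) x = 0"
  then have zero: "curv u v (ind S) x = 0"
    if "u \<noteq> v" "u \<notin> S" "v \<notin> S" "\<not> (u \<in> ?T \<and> v \<in> ?T \<and> S \<inter> ?T \<noteq> {})" for u v S
    using that curv_reversed_triangle[of u v S] by simp
  have const: "curv u v (ind S) x = curv u v (ind (S \<inter> ?T)) x"
    if "u \<noteq> v" "u \<notin> S" "v \<notin> S" for u v S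
  proof (rule curv_const)
    show "(\<forall>S'. u \<notin> S' \<longrightarrow> w \<notin> S' \<longrightarrow> curv u w (ind S') x = 0) \<or>
        (\<forall>S'. v \<notin> S' \<longrightarrow> w \<notin> S' \<longrightarrow> curv v w (ind S') x = 0)" if "w \<in> S - S \<inter> ?T" for w
    proof -
      have "u \<noteq> w" "w \<notin> ?T" using \<open>w \<in> S - S \<inter> ?T\<close> \<open>u \<notin> S\<close> by auto
      then show ?thesis using zero[of u w] by simp
    qed
  qed (use that in auto)
  \<comment> \<open>Now the values at the empty set vanish, so third differences equate the values
    at the opposite vertices.\<close>
  have "curv a b (ind {c}) x = curv a c (ind {b}) x" "curv b a (ind {c}) x = curv b c (ind {a}) x"
    using curv_insert[of c "{}" b a x] curv_insert[of c "{}" a b x]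
      zero[of a b "{}"] zero[of a c "{}"] zero[of b a "{}"] zero[of b c "{}"] distinct_abc
    by auto
  then have eq: "curv u v (ind (S \<inter> ?T)) x = curv a b (ind {c}) x"
    if "u \<in> ?T" "v \<in> ?T" "S \<inter> ?T \<noteq> {}" "u \<noteq> v" "u \<notin> S" "v \<notin> S" for u v S
  proof -
    \<comment> \<open>A set that avoids \<open>u\<close> and \<open>v\<close> but meets the triangle
      contains exactly its third vertex.\<close>
    have "S \<inter> ?T = ?T - {u, v}" using that by auto
    then show ?thesis using that(1,2,4) distinct_abc
        \<open>curv a b (ind {c}) x = curv a c (ind {b}) x\<close> \<open>curv b a (ind {c}) x = curv b c (ind {a}) x\<close>
      by (auto simp: insert_Diff_if curv_commute)
  qed
  show "\<exists>r\<ge>0. \<forall>u v S. u \<noteq> v \<longrightarrow> u \<notin> S \<longrightarrow> v \<notin> S \<longrightarrow>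
      curv u v (ind S) x = r * curv u v (ind S) (to_mod reversed_triangle)"
  proof (intro exI[of _ "curv a b (ind {c}) x"] conjI allI impI)
    show "curv a b (ind {c}) x \<ge> 0"
      using curv_nonneg[OF E x, of a b "{c}"] distinct_abc by simp
    fix u v :: 'v and S assume uv: "u \<noteq> v" "u \<notin> S" "v \<notin> S"
    then show "curv u v (ind S) x = curv a b (ind {c}) x * curv u v (ind S) (to_mod reversed_triangle)"
      using zero[OF uv] const[OF uv] eq[of u v S] curv_reversed_triangle[of u v S]
      by (cases "u \<in> ?T \<and> v \<in> ?T \<and> S \<inter> ?T \<noteq> {}") auto
  qed
qed

end

text \<open>Only the pair \<open>p, q\<close> may have nonzero second differences, and by
  \<open>curv_const\<close> these do not depend on \<open>S\<close>.\<close>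

lemma edge_ray:
  fixes E :: "'v::finite set set"
  assumes E: "simple_graph E" and "{p, q} \<in> E"
  shows "half_line (to_mod (simplex_on {p, q})) \<in> cone_rays (mod_def_cone E)"
proof (rule rigid_imp_ray[OF E simplex_on_edge_in_mod_def_cone[OF assms]])
  have pq: "p \<noteq> q" using assms unfolding simple_graph_def by fastforce
  then show "to_mod (simplex_on {p, q}) \<noteq> 0"
    using curv_to_mod_edge[of p q "{}" p q] linear_0[OF linear_curv, of p q 0] by auto
  fix x assume x: "x \<in> mod_def_cone E"
    and "\<And>u v S. u \<noteq> v \<Longrightarrow> u \<notin> S \<Longrightarrow> v \<notin> S \<Longrightarrow>
      curv u v (ind S) (to_mod (simplex_on {p, q})) = 0 \<Longrightarrow> curv u v (ind S) x = 0"
  then have zero: "curv u v (ind S) x = 0"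
    if "u \<noteq> v" "u \<notin> S" "v \<notin> S" "{u, v} \<noteq> {p, q}" for u v S
    using that curv_to_mod_edge[of u v S p q] pq by simp
  have const: "curv u v (ind S) x = curv u v 0 x"
    if "{u, v} = {p, q}" "u \<noteq> v" "u \<notin> S" "v \<notin> S" for u v S
  proof (rule curv_const[of "{}" S u v x, simplified])
    show "(\<forall>S'. u \<notin> S' \<longrightarrow> w \<notin> S' \<longrightarrow> curv u w (ind S') x = 0) \<or>
        (\<forall>S'. v \<notin> S' \<longrightarrow> w \<notin> S' \<longrightarrow> curv v w (ind S') x = 0)" if "w \<in> S" for w
    proof -
      have "u \<noteq> w" "{u, w} \<noteq> {p, q}"
        using \<open>w \<in> S\<close> \<open>{u, v} = {p, q}\<close> \<open>u \<notin> S\<close> \<open>v \<notin> S\<close> by (auto simp: doubleton_eq_iff)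
      then show ?thesis using zero by blast
    qed
  qed (use that in auto)
  show "\<exists>r\<ge>0. \<forall>u v S. u \<noteq> v \<longrightarrow> u \<notin> S \<longrightarrow> v \<notin> S \<longrightarrow>
      curv u v (ind S) x = r * curv u v (ind S) (to_mod (simplex_on {p, q}))"
  proof (intro exI[of _ "curv p q 0 x"] conjI allI impI)
    show "curv p q 0 x \<ge> 0"
      using curv_nonneg[OF E x, of p q "{}"] pq by simp
    fix u v :: 'v and S assume uv: "u \<noteq> v" "u \<notin> S" "v \<notin> S"
    show "curv u v (ind S) x = curv p q 0 x * curv u v (ind S) (to_mod (simplex_on {p, q}))"
    proof (cases "{u, v} = {p, q}")
      case True
      then have "curv u v 0 x = curv p q 0 x" by (auto simp: doubleton_eq_iff curv_commute)
      then show ?thesis using const[OF True uv] curv_to_mod_edge[OF uv pq] True by simp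
    qed (use zero[OF uv] curv_to_mod_edge[OF uv pq] in simp)
  qed
qed

lemma not_independent_rays_if_triangle:
  fixes E :: "'v::finite set set"
  assumes E: "simple_graph E" and abc: "{a, b} \<in> E" "{b, c} \<in> E" "{a, c} \<in> E"
  shows "\<not> independent_rays (mod_def_cone E)"
proof
  assume indep: "independent_rays (mod_def_cone E)"
  note distinct = distinct_abc[OF E abc]
  define s1 where "s1 = to_mod (simplex_on {a, b})"
  define s2 where "s2 = to_mod (simplex_on {b, c})"
  define s3 where "s3 = to_mod (simplex_on {a, c})"
  define t where "t = to_mod (simplex_on {a, b, c})"
  define t' where "t' = to_mod (reversed_triangle a b c)"
  define X where "X = {s1, s2, s3, t, t'}"
  \<comment> \<open>The vanishing pattern of second differences tells the five half-lines apart.\<close>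
  define sig where "sig z = (curv a b (ind {}) z = 0, curv b c (ind {}) z = 0,
    curv a b (ind {c}) z = 0, curv b c (ind {a}) z = 0, curv a c (ind {}) z = 0, curv a c (ind {b}) z = 0)"
    for z :: "(real ^ 'v) vpolytope_mod"
  note defs = s1_def s2_def s3_def t_def t'_def
  have sig: "sig s1 = (False, True, False, True, True, True)" "sig s2 = (True, False, True, False, True, True)"
    "sig s3 = (True, True, True, True, False, False)"
    "sig t = (False, False, True, True, False, True)" "sig t' = (True, True, False, False, True, False)"
    using distinct by (simp_all add: sig_def defs curv_simplex_on curv_reversed_triangle[OF E abc] del: ind_empty)
  \<comment> \<open>Each of the five patterns has a \<open>False\<close> entry, unlike that of the
    zero class.\<close>
  have "sig 0 = (True, True, True, True, True, True)"
    by (simp add: sig_def linear_0[OF linear_curv])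
  then have nz: "0 \<notin> X" unfolding X_def using sig by auto
  have sig_half_line: "sig v = sig w" if hl: "half_line v = half_line w" and v: "v \<noteq> 0" for v w
  proof -
    obtain r where "v = r *\<^sub>R w" using half_line_self[of v] hl unfolding half_line_def by auto
    then show ?thesis using v by (auto simp: sig_def curv_scaleR)
  qed
  have inj: "inj_on half_line X"
  proof (rule inj_onI)
    fix v w assume "v \<in> X" "w \<in> X" "half_line v = half_line w"
    moreover from this have "sig v = sig w" using sig_half_line nz by metis
    ultimately show "v = w" unfolding X_def by (auto simp: sig)
  qed
  have "independent X"
  proof (rule independent_rays_imp_independent[OF indep _ inj])
    fix v assume "v \<in> X"
    then show "v \<noteq> 0 \<and> half_line v \<in> cone_rays (mod_def_cone E)"
      using nz triangle_ray[OF E abc] reversed_triangle_ray[OF E abc] edge_ray[OF E abc(1)]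
        edge_ray[OF E abc(2)] edge_ray[OF E abc(3)] unfolding X_def defs by auto
  qed
  \<comment> \<open>The hexagon relation expresses one segment by the other four vectors.\<close>
  moreover have "s1 \<in> span (X - {s1})"
  proof -
    have "t + t' = s1 + s2 + s3"
      unfolding defs by (simp only: to_mod_plus[symmetric] triangle_plus_reversed_triangle[OF E abc])
    then have "s1 = t + t' - s2 - s3" by (simp add: algebra_simps)
    moreover have "t \<noteq> s1" "t' \<noteq> s1" "s2 \<noteq> s1" "s3 \<noteq> s1" using sig by auto
    then have "t \<in> X - {s1}" "t' \<in> X - {s1}" "s2 \<in> X - {s1}" "s3 \<in> X - {s1}" unfolding X_def by auto
    ultimately show ?thesis by (metis span_base span_add span_diff)
  qed
  ultimately show False unfolding dependent_def X_def by blast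
qed

theorem corollary2p10:
  fixes E :: "'v::finite set set"
  assumes "simple_graph E"
  shows "simplicial_cone (mod_translations ` deformation_cone (graphical_zonotope E))
           \<longleftrightarrow> triangle_free E"
  using simplicial_if_triangle_free[OF assms] not_independent_rays_if_triangle[OF assms]
  unfolding triangle_free_def simplicial_cone_def by metis

end
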